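(* Let $\mathbf{G}$ be any Kac-Moody group. The length function $\ell : W_{\mathcal{T}} \to \mathbb{Z}$ is strictly compatible with the Bruhat order on $W_{\mathcal{T}}$ and the usual order on $\mathbb{Z}$. That is, if $x,y \in W_{\mathcal{T}}$, $x \leq y$ and $x \neq y$, then $\ell(x) < \ell(y)$.
   Context: Setup. $\mathbf{G}$ is a Kac-Moody group with finitely many simple roots $\alpha_i$ and simple coroots $\alpha_i^\vee$, $W$ is its Weyl group, $\Delta$ its set of real roots, $\Delta^+\subset\Delta$ the positive real roots. $P$ is the coweight lattice of $\mathbf{G}$ (it contains the coroots and carries an action of $W$), and $\langle\cdot,\cdot\rangle$ is the canonical $W$-invariant pairing between $P$ and the root lattice. For $\beta\in\Delta$, $\beta^\vee$ is the associated coroot and $s_\beta\in W$ the reflection. A coweight $\mu\in P$ is dominant if $\langle\mu,\alpha_i\rangle\ge 0$ for all $i$. The Tits cone $\mathcal{T}\subset P$ is the set of $\mu\in P$ such that $w(\mu)$ is dominant for some $w\in W$; $\mu_+$ denotes the unique dominant element of the $W$-orbit of $\mu\in\mathcal{T}$. $W_P=P\rtimes W$ has elements written $\pi^\mu w$ ($\mu\in P$, $w\in W$), and $W_{\mathcal{T}}=\mathcal{T}\rtimes W=\{\pi^\mu w : \mu\in\mathcal{T}, w\in W\}$ is a subsemigroup of $W_P$. $\mathbf{G}$-affine roots: $\tilde\Delta=\{\beta+n\pi : \beta\in\Delta, n\in\mathbb{Z}\}\subset \mathbb{Z}\Delta\oplus\mathbb{Z}\pi$, where $\pi$ is a formal symbol.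 $\beta+n\pi$ is positive ($>0$) if ($\beta\in\Delta^+$ and $n\ge 0$) or ($\beta\in-\Delta^+$ and $n>0$); otherwise it is negative ($<0$). $\tilde\Delta^+$ is the set of positive elements. For $\beta\in\Delta^+$, $n\in\mathbb{Z}$, set $\beta[n]=\mathrm{sgn}(n)(\beta+n\pi)$, where $\mathrm{sgn}(n)=+1$ if $n\ge0$ and $-1$ if $n<0$; every element of $\tilde\Delta^+$ is uniquely of the form $\beta[n]$. $W_P$ acts on $\tilde\Delta$ by $\pi^\mu w(\beta+n\pi)=w(\beta)+(n+\langle\mu,w(\beta)\rangle)\pi$. The reflection of $\beta[n]$ is $s_{\beta[n]}=\pi^{n\beta^\vee}s_\beta\in W_P$. Bruhat order: for $x\in W_{\mathcal{T}}$ and $\beta[n]\in\tilde\Delta^+$ with $xs_{\beta[n]}\in W_{\mathcal{T}}$ and $x(\beta[n])>0$, declare $xs_{\beta[n]}>x$; the Bruhat order $\leq$ on $W_{\mathcal{T}}$ is the reflexive and transitive closure of these relations (it is known to be a partial order). Length function: fix $\rho$, a sum of fundamental weights, so $\langle\alpha_i^\vee,\rho\rangle=1$ for all $i$. For $\mu\in P$ put $2\cdot\mathrm{ht}(\mu)=\lfloor\langle\mu,2\rho\rangle\rfloor$. For $w\in W$ let $\mathrm{Inv}(w)=\{\gamma\in\Delta^+ : w(\gamma)\in-\Delta^+\}$. For $\pi^\mu w\in W_{\mathcal{T}}$, $$\ell(\pi^\mu w)=2\cdot\mathrm{ht}(\mu_+)+\#\{\gamma\in\mathrm{Inv}(w^{-1})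 : \langle\mu,\gamma\rangle\ge0\}-\#\{\gamma\in\mathrm{Inv}(w^{-1}) : \langle\mu,\gamma\rangle<0\}.$$ *)

theory Defs
  imports Complex_Main "HOL-Library.Poly_Mapping"
begin

section \<open>Lattices\<close>

text \<open>The multiple \<open>n \<cdot> x\<close> in an abelian group; it is the only \<open>\<int>\<close>-module structure.\<close>

definition zscale :: "int \<Rightarrow> 'a::ab_group_add \<Rightarrow> 'a"
  where "zscale n x = (\<Sum>k<nat n. x) - (\<Sum>k<nat (- n). x)"

lemma zscale_0 [simp]: "zscale 0 x = 0"
  by (simp add: zscale_def)

lemma zscale_add1: "zscale (n + 1) x = zscale n x + x"
proof (cases "n \<ge> 0")
  case True
  then have "nat (n + 1) = Suc (nat n)" "nat (- n) = 0" "nat (- (n + 1)) = 0"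
    by auto
  then show ?thesis by (simp add: zscale_def)
next
  case False
  then have "nat (n + 1) = 0" "nat n = 0" "nat (- n) = Suc (nat (- (n + 1)))"
    by auto
  then show ?thesis by (simp add: zscale_def)
qed

lemma zscale_1 [simp]: "zscale 1 x = x"
  by (simp add: zscale_def)

lemma zscale_diff1: "zscale (n - 1) x = zscale n x - x"
  using zscale_add1[of "n - 1" x] by (simp add: algebra_simps)

lemma zscale_add_left: "zscale (m + n) x = zscale m x + zscale n x"
proof (induction m rule: int_induct[where k = 0])
  case (step1 i)
  have "i + 1 + n = (i + n) + 1" by simp
  then show ?case by (simp only: zscale_add1 step1) (simp add: algebra_simps)
next
  case (step2 i)
  have "i - 1 + n = (i + n) - 1" by simp
  then show ?case by (simp only: zscale_diff1 step2) (simp add: algebra_simps)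
qed simp

lemma zscale_add_right: "zscale n (x + y) = zscale n x + zscale n y"
  by (simp add: zscale_def sum.distrib)

lemma zscale_zscale: "zscale m (zscale n x) = zscale (m * n) x"
proof (induction m rule: int_induct[where k = 0])
  case (step1 i)
  then show ?case by (simp add: distrib_right zscale_add_left)
next
  case (step2 i)
  have "zscale (i * n) x = zscale ((i - 1) * n) x + zscale n x"
    using zscale_add_left[of "(i - 1) * n" n x] by (simp add: algebra_simps)
  then show ?case by (simp add: zscale_diff1 step2)
qed simp

interpretation zmod: module "zscale :: int \<Rightarrow> 'a::ab_group_add \<Rightarrow> 'a"
  by unfold_locales (auto simp: zscale_add_left zscale_add_right zscale_zscale)

section \<open>Kac-Moody root data\<close>

text \<open>
  The coweight lattice \<open>P\<close> is the type \<open>'p\<close>. The root lattice is the free abelian group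
  on the simple roots, so a root is a finitely supported function of the index of the
  simple root; simple roots need not be independent as functionals on \<open>P\<close>.
\<close>

type_synonym 'i root = "'i \<Rightarrow>\<^sub>0 int"

record ('i, 'p) km_datum =
  idx :: "'i set"
  simple_coroot :: "'i \<Rightarrow> 'p"
  simple_functional :: "'i \<Rightarrow> 'p \<Rightarrow> int"  \<comment> \<open>\<open>\<mu> \<mapsto> \<langle>\<mu>, \<alpha>\<^sub>i\<rangle>\<close>\<close>

abbreviation simple_root :: "'i \<Rightarrow> 'i root"
  where "simple_root i \<equiv> frag_of i"

text \<open>The last three axioms say that \<open>(\<langle>\<alpha>\<^sub>i\<^sup>\<or>, \<alpha>\<^sub>j\<rangle>)\<close> is a generalised Cartan matrix.\<close>

locale km_root_datum =
  fixes D :: "('i, 'p::ab_group_add) km_datum"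
  assumes finite_idx: "finite (idx D)"
    and coweight_lattice: "\<exists>B::'p set. finite B \<and> zmod.independent B \<and> zmod.span B = UNIV"
    and additive_functional: "i \<in> idx D \<Longrightarrow> additive (simple_functional D i)"
    and cartan_diag: "i \<in> idx D \<Longrightarrow> simple_functional D i (simple_coroot D i) = 2"
    and cartan_nonpos: "\<lbrakk>i \<in> idx D; j \<in> idx D; i \<noteq> j\<rbrakk> \<Longrightarrow>
          simple_functional D j (simple_coroot D i) \<le> 0"
    and cartan_zero: "\<lbrakk>i \<in> idx D; j \<in> idx D; simple_functional D j (simple_coroot D i) = 0\<rbrakk> \<Longrightarrow>
          simple_functional D i (simple_coroot D j) = 0"

definition pairing :: "('i, 'p) km_datum \<Rightarrow> 'p \<Rightarrow> 'i root \<Rightarrow> int"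
  where "pairing D \<mu> q = (\<Sum>i\<in>idx D. Poly_Mapping.lookup q i * simple_functional D i \<mu>)"

section \<open>The Weyl group and real roots\<close>

text \<open>
  An element of the Weyl group is encoded by its two actions, on the root lattice and on \<open>P\<close>.
  The action on the root lattice alone is faithful, the one on \<open>P\<close> need not be.
\<close>

type_synonym ('i, 'p) weyl = "('i root \<Rightarrow> 'i root) \<times> ('p \<Rightarrow> 'p)"

abbreviation act_root :: "('i, 'p) weyl \<Rightarrow> 'i root \<Rightarrow> 'i root"
  where "act_root w \<equiv> fst w"

abbreviation act_coweight :: "('i, 'p) weyl \<Rightarrow> 'p \<Rightarrow> 'p"
  where "act_coweight w \<equiv> snd w"

definition wmult :: "('i, 'p) weyl \<Rightarrow> ('i, 'p) weyl \<Rightarrow> ('i, 'p) weyl"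
  where "wmult v w = (act_root v \<circ> act_root w, act_coweight v \<circ> act_coweight w)"

definition winv :: "('i, 'p) weyl \<Rightarrow> ('i, 'p) weyl"
  where "winv w = (inv (act_root w), inv (act_coweight w))"

text \<open>The reflection determined by a root \<open>\<beta>\<close> together with its coroot \<open>\<mu>\<close>.\<close>

definition refl_of :: "('i, 'p::ab_group_add) km_datum \<Rightarrow> 'i root \<Rightarrow> 'p \<Rightarrow> ('i, 'p) weyl"
  where "refl_of D \<beta> \<mu> =
    (\<lambda>q. q - frag_cmul (pairing D \<mu> q) \<beta>, \<lambda>\<nu>. \<nu> - zscale (pairing D \<nu> \<beta>) \<mu>)"

text \<open>As simple reflections are involutions, the monoid they generate is a group.\<close>

inductive_set weyl_group :: "('i, 'p::ab_group_add) km_datum \<Rightarrow> ('i, 'p) weyl set"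
  for D :: "('i, 'p) km_datum"
  where
    one: "(id, id) \<in> weyl_group D"
  | simple: "\<lbrakk>i \<in> idx D; w \<in> weyl_group D\<rbrakk> \<Longrightarrow>
      wmult (refl_of D (simple_root i) (simple_coroot D i)) w \<in> weyl_group D"

definition real_roots :: "('i, 'p::ab_group_add) km_datum \<Rightarrow> 'i root set"
  where "real_roots D = {act_root w (simple_root i) | w i. w \<in> weyl_group D \<and> i \<in> idx D}"

definition pos_roots :: "('i, 'p::ab_group_add) km_datum \<Rightarrow> 'i root set"
  where "pos_roots D = {\<beta> \<in> real_roots D. \<forall>i. Poly_Mapping.lookup \<beta> i \<ge> 0}"

definition neg_roots :: "('i, 'p::ab_group_add) km_datum \<Rightarrow> 'i root set"
  where "neg_roots D = uminus ` pos_roots D"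

text \<open>The coroot of \<open>w \<alpha>\<^sub>i\<close> is \<open>w \<alpha>\<^sub>i\<^sup>\<or>\<close>; it does not depend on the choice of \<open>w\<close> and \<open>i\<close>.\<close>

definition coroot :: "('i, 'p::ab_group_add) km_datum \<Rightarrow> 'i root \<Rightarrow> 'p"
  where "coroot D \<beta> = (THE \<mu>. \<exists>w\<in>weyl_group D. \<exists>i\<in>idx D.
    \<beta> = act_root w (simple_root i) \<and> \<mu> = act_coweight w (simple_coroot D i))"

definition reflection :: "('i, 'p::ab_group_add) km_datum \<Rightarrow> 'i root \<Rightarrow> ('i, 'p) weyl"
  where "reflection D \<beta> = refl_of D \<beta> (coroot D \<beta>)"

definition inversions :: "('i, 'p::ab_group_add) km_datum \<Rightarrow> ('i, 'p) weyl \<Rightarrow> 'i root set"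
  where "inversions D w = {\<gamma> \<in> pos_roots D. act_root w \<gamma> \<in> neg_roots D}"

section \<open>The Tits cone\<close>

definition dominant :: "('i, 'p) km_datum \<Rightarrow> 'p \<Rightarrow> bool"
  where "dominant D \<mu> \<longleftrightarrow> (\<forall>i\<in>idx D. pairing D \<mu> (simple_root i) \<ge> 0)"

definition tits_cone :: "('i, 'p::ab_group_add) km_datum \<Rightarrow> 'p set"
  where "tits_cone D = {\<mu>. \<exists>w\<in>weyl_group D. dominant D (act_coweight w \<mu>)}"

definition dominant_rep :: "('i, 'p::ab_group_add) km_datum \<Rightarrow> 'p \<Rightarrow> 'p"
  where "dominant_rep D \<mu> = (THE \<nu>. dominant D \<nu> \<and> (\<exists>w\<in>weyl_group D. \<nu> = act_coweight w \<mu>))"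

section \<open>The affine Weyl semigroup and affine roots\<close>

text \<open>\<open>(\<mu>, w)\<close> stands for \<open>\<pi>\<^sup>\<mu> w\<close>, and \<open>(\<beta>, n)\<close> for the affine root \<open>\<beta> + n \<pi>\<close>.\<close>

type_synonym ('i, 'p) aff_weyl = "'p \<times> ('i, 'p) weyl"

type_synonym 'i aff_root = "'i root \<times> int"

definition aff_mult ::
    "('i, 'p::ab_group_add) aff_weyl \<Rightarrow> ('i, 'p) aff_weyl \<Rightarrow> ('i, 'p) aff_weyl"
  where "aff_mult x y =
    (fst x + act_coweight (snd x) (fst y), wmult (snd x) (snd y))"

definition aff_weyl_semigroup ::
    "('i, 'p::ab_group_add) km_datum \<Rightarrow> ('i, 'p) aff_weyl set"
  where "aff_weyl_semigroup D = tits_cone D \<times> weyl_group D"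

fun aff_act ::
    "('i, 'p) km_datum \<Rightarrow> ('i, 'p) aff_weyl \<Rightarrow> 'i aff_root \<Rightarrow> 'i aff_root"
  where "aff_act D (\<mu>, w) (\<beta>, n) = (act_root w \<beta>, n + pairing D \<mu> (act_root w \<beta>))"

fun aff_pos :: "('i, 'p::ab_group_add) km_datum \<Rightarrow> 'i aff_root \<Rightarrow> bool"
  where "aff_pos D (\<beta>, n) \<longleftrightarrow> \<beta> \<in> pos_roots D \<and> n \<ge> 0 \<or> \<beta> \<in> neg_roots D \<and> n > 0"

text \<open>The root \<open>\<beta>[n] = sgn(n) (\<beta> + n \<pi>)\<close>, where \<open>sgn(0) = 1\<close> (unlike the library's \<open>sgn\<close>).\<close>

definition aff_root_of :: "'i root \<Rightarrow> int \<Rightarrow> 'i aff_root"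
  where "aff_root_of \<beta> n = (if n \<ge> 0 then (\<beta>, n) else (- \<beta>, - n))"

definition aff_reflection ::
    "('i, 'p::ab_group_add) km_datum \<Rightarrow> 'i root \<Rightarrow> int \<Rightarrow> ('i, 'p) aff_weyl"
  where "aff_reflection D \<beta> n = (zscale n (coroot D \<beta>), reflection D \<beta>)"

section \<open>Bruhat order and length\<close>

definition bruhat_step ::
    "('i, 'p::ab_group_add) km_datum \<Rightarrow> ('i, 'p) aff_weyl \<Rightarrow> ('i, 'p) aff_weyl \<Rightarrow> bool"
  where "bruhat_step D x y \<longleftrightarrow>
    x \<in> aff_weyl_semigroup D \<and> y \<in> aff_weyl_semigroup D \<and>
    (\<exists>\<beta>\<in>pos_roots D. \<exists>n. y = aff_mult x (aff_reflection D \<beta> n) \<and>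
      aff_pos D (aff_act D x (aff_root_of \<beta> n)))"

definition bruhat_le ::
    "('i, 'p::ab_group_add) km_datum \<Rightarrow> ('i, 'p) aff_weyl \<Rightarrow> ('i, 'p) aff_weyl \<Rightarrow> bool"
  where "bruhat_le D = (bruhat_step D)\<^sup>*\<^sup>*"

text \<open>
  Fundamental weights are only determined by the coroots up to functionals vanishing on
  the coroots, and they need not be integral on \<open>P\<close>.
\<close>

definition fundamental_weights ::
    "('i, 'p::ab_group_add) km_datum \<Rightarrow> ('i \<Rightarrow> 'p \<Rightarrow> real) \<Rightarrow> bool"
  where "fundamental_weights D \<Lambda> \<longleftrightarrow>
    (\<forall>i\<in>idx D. additive (\<Lambda> i) \<and>
      (\<forall>j\<in>idx D. \<Lambda> i (simple_coroot D j) = (if i = j then 1 else 0)))"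

definition is_rho :: "('i, 'p::ab_group_add) km_datum \<Rightarrow> ('p \<Rightarrow> real) \<Rightarrow> bool"
  where "is_rho D \<rho> \<longleftrightarrow>
    (\<exists>\<Lambda>. fundamental_weights D \<Lambda> \<and> \<rho> = (\<lambda>\<mu>. \<Sum>i\<in>idx D. \<Lambda> i \<mu>))"

definition two_ht :: "('p \<Rightarrow> real) \<Rightarrow> 'p \<Rightarrow> int"
  where "two_ht \<rho> \<mu> = \<lfloor>2 * \<rho> \<mu>\<rfloor>"

fun aff_length ::
    "('i, 'p::ab_group_add) km_datum \<Rightarrow> ('p \<Rightarrow> real) \<Rightarrow> ('i, 'p) aff_weyl \<Rightarrow> int"
  where "aff_length D \<rho> (\<mu>, w) =
    two_ht \<rho> (dominant_rep D \<mu>)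
    + int (card {\<gamma> \<in> inversions D (winv w). pairing D \<mu> \<gamma> \<ge> 0})
    - int (card {\<gamma> \<in> inversions D (winv w). pairing D \<mu> \<gamma> < 0})"

end

theory Submission
  imports Defs
begin

text \<open>
  Let \<open>len(w)\<close> be the number of inversions of \<open>w\<close>. Write \<open>\<pi>\<^sup>\<mu> w = v \<pi>\<^sup>l u\<close> with \<open>l\<close> dominant and \<open>\<mu> = v l\<close>. Then \<open>2 ht(l) - len(v) + len(u)\<close> is at most
  the length of \<open>\<pi>\<^sup>\<mu> w\<close>, with equality if \<open>v\<close> is minimal modulo the stabiliser of \<open>l\<close>; so for an
  upward step it suffices to exhibit one factorisation of the larger element with a large value.
  If the step keeps \<open>\<mu>\<close> in its orbit, multiply \<open>u\<close> or \<open>v\<close> by a reflection that makes \<open>u\<close> longer or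
  \<open>v\<close> shorter. Otherwise the new coweight is conjugate to \<open>\<nu> = l + k \<delta>\<^sup>\<or>\<close> with \<open>\<delta> > 0\<close>, \<open>k > 0\<close>. If
  \<open>\<nu> = z l'\<close> with \<open>l'\<close> dominant and \<open>z\<close> minimal, then \<open>v\<close> and \<open>u\<close> change by \<open>z\<close> and \<open>s\<^sub>\<delta> z\<close>, which
  costs at most \<open>len(z) + len(s\<^sub>\<delta> z)\<close>, and the height gain \<open>2 ht(l') - 2 ht(l)\<close> is larger: it is
  \<open>k \<langle>\<delta>\<^sup>\<or>, 2\<rho>\<rangle>\<close> minus twice the sum of \<open>\<langle>\<nu>, \<gamma>\<rangle>\<close> over the inversions \<open>\<gamma>\<close> of \<open>z\<^sup>-\<^sup>1\<close>, where each
  \<open>\<langle>\<nu>, \<gamma>\<rangle> < 0\<close> and \<open>\<langle>\<delta>\<^sup>\<or>, 2\<rho>\<rangle> > len(s\<^sub>\<delta>)\<close>.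
\<close>

section \<open>The Weyl group of a root datum\<close>

lemma additive_zscale:
  assumes "additive f"
  shows "f (zscale n x) = zscale n (f x)"
proof (induction n rule: int_induct[where k = 0])
  case base
  show ?case by (simp add: additive.zero[OF assms])
next
  case (step1 i)
  then show ?case by (simp add: zscale_add_left additive.add[OF assms])
next
  case (step2 i)
  then show ?case by (simp add: zscale_diff1 additive.diff[OF assms])
qed

lemma zscale_int [simp]: "zscale n (x :: int) = n * x"
proof (induction n rule: int_induct[where k = 0])
  case (step2 i)
  then show ?case by (simp add: zscale_diff1 algebra_simps)
qed (simp_all add: zscale_add_left algebra_simps)

lemma zscale_real [simp]: "zscale n (x :: real) = of_int n * x"
proof (induction n rule: int_induct[where k = 0])
  case (step2 i)
  then show ?case by (simp add: zscale_diff1 algebra_simps)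
qed (simp_all add: zscale_add_left algebra_simps)

lemmas zscale_algebra =
  zscale_add_left zmod.scale_left_diff_distrib zmod.scale_minus_left
  zscale_add_right zmod.scale_right_diff_distrib zmod.scale_minus_right zscale_zscale

lemma zscale_mult_2: "zscale (n * 2) x = zscale n x + zscale n x"
  by (simp add: zscale_add_left[symmetric] mult_2_right)

lemma zscale_2: "zscale 2 x = x + x"
  using zscale_mult_2[of 1 x] by simp

context km_root_datum
begin

notation wmult (infixl "\<cdot>" 70)

abbreviation pair (\<open>\<langle>_,_\<rangle>\<close>) where "\<langle>\<mu>,q\<rangle> \<equiv> pairing D \<mu> q"

abbreviation W where "W \<equiv> weyl_group D"

definition e :: "('i, 'p) weyl" where "e = (id, id)"

abbreviation \<alpha> :: "'i \<Rightarrow> 'i root" where "\<alpha> i \<equiv> simple_root i"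

abbreviation \<alpha>v :: "'i \<Rightarrow> 'p" where "\<alpha>v i \<equiv> simple_coroot D i"

abbreviation s where "s i \<equiv> refl_of D (\<alpha> i) (\<alpha>v i)"

section \<open>The pairing, simple reflections and the group structure of \<open>W\<close>\<close>

lemma pairing_add_left: "\<langle>\<mu> + \<nu>,q\<rangle> = \<langle>\<mu>,q\<rangle> + \<langle>\<nu>,q\<rangle>"
  by (simp add: pairing_def additive.add[OF additive_functional] sum.distrib[symmetric] algebra_simps)

lemma pairing_add_right: "\<langle>\<mu>,p + q\<rangle> = \<langle>\<mu>,p\<rangle> + \<langle>\<mu>,q\<rangle>"
  by (simp add: pairing_def lookup_add sum.distrib[symmetric] algebra_simps)

lemma additive_pairing_left: "additive (\<lambda>\<mu>. \<langle>\<mu>,q\<rangle>)"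
  by unfold_locales (rule pairing_add_left)

lemma additive_pairing_right: "additive (pairing D \<mu>)"
  by unfold_locales (rule pairing_add_right)

lemma pairing_cmul_right: "\<langle>\<mu>,frag_cmul n q\<rangle> = n * \<langle>\<mu>,q\<rangle>"
  by (simp add: pairing_def sum_distrib_left algebra_simps)

lemmas pairing_simps = pairing_add_left pairing_add_right
  additive.zero[OF additive_pairing_left] additive.zero[OF additive_pairing_right]
  additive.minus[OF additive_pairing_left] additive.minus[OF additive_pairing_right]
  additive.diff[OF additive_pairing_left] additive.diff[OF additive_pairing_right]
  additive_zscale[OF additive_pairing_left] pairing_cmul_right

lemma pairing_simple: "i \<in> idx D \<Longrightarrow> \<langle>\<mu>,\<alpha> i\<rangle> = simple_functional D i \<mu>"
  by (simp add: pairing_def if_distribR if_distrib finite_idx sum.delta cong: if_cong)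

lemma pairing_simple_self [simp]: "i \<in> idx D \<Longrightarrow> \<langle>\<alpha>v i,\<alpha> i\<rangle> = 2"
  by (simp add: pairing_simple cartan_diag)

lemma wmult_assoc: "u \<cdot> (v \<cdot> w) = u \<cdot> v \<cdot> w"
  by (simp add: wmult_def comp_assoc)

lemma wmult_e [simp]: "e \<cdot> w = w" "w \<cdot> e = w"
  by (simp_all add: wmult_def e_def)

lemma e_in_W: "e \<in> W"
  by (simp add: e_def weyl_group.one)

lemma act_wmult [simp]:
  "act_root (v \<cdot> w) q = act_root v (act_root w q)"
  "act_coweight (v \<cdot> w) \<mu> = act_coweight v (act_coweight w \<mu>)"
  by (simp_all add: wmult_def)

lemma act_e [simp]: "act_root e q = q" "act_coweight e \<mu> = \<mu>"
  by (simp_all add: e_def)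

lemma weyl_eqI:
  fixes v w :: "('i, 'p) weyl"
  assumes "\<And>q. act_root v q = act_root w q" "\<And>\<mu>. act_coweight v \<mu> = act_coweight w \<mu>"
  shows "v = w"
  using assms by (auto simp: prod_eq_iff)

lemma act_refl:
  "act_root (refl_of D \<beta> \<mu>) q = q - frag_cmul \<langle>\<mu>,q\<rangle> \<beta>"
  "act_coweight (refl_of D \<beta> \<mu>) \<nu> = \<nu> - zscale \<langle>\<nu>,\<beta>\<rangle> \<mu>"
  by (simp_all add: refl_of_def)

lemma refl_involution:
  assumes "\<langle>\<mu>,\<beta>\<rangle> = 2"
  shows "refl_of D \<beta> \<mu> \<cdot> refl_of D \<beta> \<mu> = e"
proof -
  have "act_root (refl_of D \<beta> \<mu> \<cdot> refl_of D \<beta> \<mu>) q = q" for q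
    by (rule poly_mapping_eqI)
      (simp add: act_refl pairing_simps assms lookup_minus lookup_add algebra_simps del: minus_frag_cmul)
  moreover have "act_coweight (refl_of D \<beta> \<mu> \<cdot> refl_of D \<beta> \<mu>) \<nu> = \<nu>" for \<nu>
    by (simp add: act_refl pairing_simps assms zscale_algebra algebra_simps)
  ultimately show ?thesis by (simp add: weyl_eqI)
qed

lemma s_s [simp]: "i \<in> idx D \<Longrightarrow> s i \<cdot> s i = e"
  by (simp add: refl_involution)

lemma wmult_s_s [simp]: "i \<in> idx D \<Longrightarrow> w \<cdot> s i \<cdot> s i = w"
  by (metis wmult_assoc s_s wmult_e(2))

lemma s_in_W: "i \<in> idx D \<Longrightarrow> s i \<in> W"
  using weyl_group.simple[OF _ e_in_W] by simp

lemma wmult_in_W: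
  assumes "v \<in> W" "w \<in> W"
  shows "v \<cdot> w \<in> W"
  using assms by induction (auto simp: wmult_assoc[symmetric] e_def[symmetric] intro: weyl_group.intros)

text \<open>\<open>weyl_group\<close> is generated as a monoid by left multiplication; the inverse
  is built along the same induction by multiplying with the same simple reflections on the
  right.\<close>

lemma W_inverse:
  assumes "w \<in> W"
  obtains w' where "w' \<in> W" "w \<cdot> w' = e" "w' \<cdot> w = e"
proof -
  from assms have "\<exists>w'\<in>W. w \<cdot> w' = e \<and> w' \<cdot> w = e"
  proof induction
    case one
    show ?case unfolding e_def[symmetric] by (rule bexI[of _ e]) (simp_all add: e_in_W)
  next
    case (simple i w)
    then obtain w' where w': "w' \<in> W" "w \<cdot> w' = e" "w' \<cdot> w = e" by blast
    have "s i \<cdot> w \<cdot> (w' \<cdot> s i) = s i \<cdot> (w \<cdot> w') \<cdot> s i"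
      by (simp only: wmult_assoc)
    moreover have "w' \<cdot> s i \<cdot> (s i \<cdot> w) = w' \<cdot> (s i \<cdot> s i) \<cdot> w"
      by (simp only: wmult_assoc)
    ultimately show ?case
      using w' simple.hyps(1) by (intro bexI[of _ "w' \<cdot> s i"]) (simp_all add: wmult_in_W s_in_W)
  qed
  then show ?thesis using that by blast
qed

lemma winv_eq:
  assumes "v \<cdot> w = e" "w \<cdot> v = e"
  shows "winv w = v"
proof -
  have "inv (act_root w) = act_root v"
    using assms by (intro inv_unique_comp) (simp_all add: wmult_def e_def)
  moreover have "inv (act_coweight w) = act_coweight v"
    using assms by (intro inv_unique_comp) (simp_all add: wmult_def e_def)
  ultimately show ?thesis by (simp add: winv_def)
qed

lemma winv:
  assumes "w \<in> W"
  shows winv_in_W: "winv w \<in> W"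
    and wmult_winv: "w \<cdot> winv w = e"
    and winv_wmult: "winv w \<cdot> w = e"
    and winv_winv: "winv (winv w) = w"
proof -
  obtain w' where w': "w' \<in> W" "w \<cdot> w' = e" "w' \<cdot> w = e"
    using W_inverse[OF assms] .
  then have "winv w = w'" "winv w' = w" by (auto intro: winv_eq)
  with w' show "winv w \<in> W" "w \<cdot> winv w = e" "winv w \<cdot> w = e" "winv (winv w) = w" by simp_all
qed

lemma winv_wmult_distrib:
  assumes "v \<in> W" "w \<in> W"
  shows "winv (v \<cdot> w) = winv w \<cdot> winv v"
proof (rule winv_eq)
  show "winv w \<cdot> winv v \<cdot> (v \<cdot> w) = e"
    using assms by (metis wmult_assoc winv_wmult wmult_e(1))
  show "v \<cdot> w \<cdot> (winv w \<cdot> winv v) = e"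
    using assms by (metis wmult_assoc wmult_winv wmult_e(1))
qed

lemma winv_e [simp]: "winv e = e"
  by (rule winv_eq) simp_all

lemma act_winv:
  assumes "w \<in> W"
  shows "act_root (winv w) (act_root w q) = q" "act_root w (act_root (winv w) q) = q"
    "act_coweight (winv w) (act_coweight w \<mu>) = \<mu>" "act_coweight w (act_coweight (winv w) \<mu>) = \<mu>"
  using winv_wmult[OF assms] wmult_winv[OF assms] by (metis act_wmult act_e)+

lemma winv_cancel:
  assumes "v \<in> W"
  shows "winv v \<cdot> (v \<cdot> w) = w" "v \<cdot> (winv v \<cdot> w) = w"
    "w \<cdot> v \<cdot> winv v = w" "w \<cdot> winv v \<cdot> v = w"
  using winv_wmult[OF assms] wmult_winv[OF assms] by (metis wmult_assoc wmult_e)+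

lemma act_root_add:
  assumes "w \<in> W"
  shows "act_root w (p + q) = act_root w p + act_root w q"
  using assms
proof (induction arbitrary: p q)
  case (simple i w)
  then show ?case
    by (simp add: act_refl pairing_simps frag_cmul_distrib)
qed simp

lemma act_coweight_add:
  assumes "w \<in> W"
  shows "act_coweight w (\<mu> + \<nu>) = act_coweight w \<mu> + act_coweight w \<nu>"
  using assms
proof (induction arbitrary: \<mu> \<nu>)
  case (simple i w)
  then show ?case
    by (simp add: act_refl pairing_simps zscale_algebra)
qed simp

lemma additive_act:
  assumes "w \<in> W"
  shows "additive (act_root w)" "additive (act_coweight w)"
  using act_root_add[OF assms] act_coweight_add[OF assms] by (simp_all add: additive_def)

lemma frag_cmul_eq_zscale: "frag_cmul n q = zscale n q"
proof (induction n rule: int_induct[where k = 0])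
  case (step2 i)
  then show ?case by (simp add: zscale_diff1 frag_cmul_diff_distrib)
qed (simp_all add: zscale_add_left frag_cmul_distrib)

lemma act_root_cmul: "w \<in> W \<Longrightarrow> act_root w (frag_cmul n q) = frag_cmul n (act_root w q)"
  by (simp add: frag_cmul_eq_zscale additive_zscale additive_act)

lemmas act_simps = act_root_add act_coweight_add act_root_cmul
  additive.zero[OF additive_act(1)] additive.zero[OF additive_act(2)]
  additive.minus[OF additive_act(1)] additive.minus[OF additive_act(2)]
  additive.diff[OF additive_act(1)] additive.diff[OF additive_act(2)]
  additive_zscale[OF additive_act(2)]

lemma pairing_invariant:
  assumes "w \<in> W"
  shows "\<langle>act_coweight w \<mu>,act_root w q\<rangle> = \<langle>\<mu>,q\<rangle>"
  using assms
proof (induction arbitrary: \<mu> q)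
  case (simple i w)
  have "\<langle>act_coweight (s i) \<nu>,act_root (s i) p\<rangle> = \<langle>\<nu>,p\<rangle>" for \<nu> p
    using simple.hyps(1) by (simp add: act_refl pairing_simps algebra_simps)
  with simple.IH show ?case by simp
qed simp

lemma pairing_act_left:
  assumes "w \<in> W"
  shows "\<langle>act_coweight w \<mu>,q\<rangle> = \<langle>\<mu>,act_root (winv w) q\<rangle>"
  using pairing_invariant[OF assms, of \<mu> "act_root (winv w) q"] by (simp add: act_winv assms)

lemma pairing_act_right:
  assumes "w \<in> W"
  shows "\<langle>\<mu>,act_root w q\<rangle> = \<langle>act_coweight (winv w) \<mu>,q\<rangle>"
  using pairing_invariant[OF assms, of "act_coweight (winv w) \<mu>" q] by (simp add: act_winv assms)

section \<open>Words in the simple reflections\<close>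

text \<open>The head of a word is the factor that is applied first.\<close>

fun val :: "'i list \<Rightarrow> ('i, 'p) weyl" where
  "val [] = e"
| "val (i # xs) = val xs \<cdot> s i"

lemma val_append: "val (xs @ ys) = val ys \<cdot> val xs"
  by (induction xs) (simp_all add: wmult_assoc)

lemma val_in_W: "set xs \<subseteq> idx D \<Longrightarrow> val xs \<in> W"
  by (induction xs) (auto intro: e_in_W wmult_in_W s_in_W)

lemma W_word:
  assumes "w \<in> W"
  obtains xs where "set xs \<subseteq> idx D" "val xs = w"
proof -
  from assms have "\<exists>xs. set xs \<subseteq> idx D \<and> val xs = w"
  proof induction
    case one
    then show ?case by (intro exI[of _ "[]"]) (simp add: e_def)
  next
    case (simple i w)
    then obtain xs where "set xs \<subseteq> idx D" "val xs = w" by blast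
    with simple.hyps show ?case by (intro exI[of _ "xs @ [i]"]) (simp add: val_append)
  qed
  then show ?thesis using that by blast
qed

text \<open>Word length drives the induction behind the sign-coherence of roots; the length
  estimates later on use the inversion count \<open>len\<close>.\<close>

definition wlen :: "('i, 'p) weyl \<Rightarrow> nat"
  where "wlen w = (LEAST n. \<exists>xs. set xs \<subseteq> idx D \<and> val xs = w \<and> length xs = n)"

lemma wlen_le: "set xs \<subseteq> idx D \<Longrightarrow> wlen (val xs) \<le> length xs"
  unfolding wlen_def by (rule Least_le) blast

lemma reduced_word:
  assumes "w \<in> W"
  obtains xs where "set xs \<subseteq> idx D" "val xs = w" "length xs = wlen w"
proof -
  obtain ys where "set ys \<subseteq> idx D" "val ys = w" using W_word[OF assms] .
  then have "\<exists>n xs. set xs \<subseteq> idx D \<and> val xs = w \<and> length xs = n" by blast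
  from LeastI_ex[OF this] show ?thesis using that unfolding wlen_def by blast
qed

lemma wlen_append:
  assumes "v \<in> W" "set xs \<subseteq> idx D"
  shows "wlen (v \<cdot> val xs) \<le> wlen v + length xs"
proof -
  obtain ys where "set ys \<subseteq> idx D" "val ys = v" "length ys = wlen v"
    using reduced_word[OF assms(1)] .
  then show ?thesis
    using wlen_le[of "xs @ ys"] assms(2) by (simp add: val_append)
qed

section \<open>Subgroups generated by two simple reflections\<close>

fun altw :: "nat \<Rightarrow> 'i \<Rightarrow> 'i \<Rightarrow> 'i list" where
  "altw 0 i j = []"
| "altw (Suc n) i j = i # altw n j i"

text \<open>The span of two simple roots is stable under both reflections, so a word in these two
  letters acts on the coordinates (x, y).\<close>

definition comb :: "'i \<Rightarrow> 'i \<Rightarrow> int \<Rightarrow> int \<Rightarrow> 'i root"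
  where "comb i j x y = frag_cmul x (\<alpha> i) + frag_cmul y (\<alpha> j)"

lemma comb_swap: "comb i j x y = comb j i y x"
  by (simp add: comb_def add.commute)

lemma act_comb: "w \<in> W \<Longrightarrow>
    act_root w (comb i j x y) = frag_cmul x (act_root w (\<alpha> i)) + frag_cmul y (act_root w (\<alpha> j))"
  by (simp add: comb_def act_simps)

lemma s_comb_left:
  assumes "i \<in> idx D"
  shows "act_root (s i) (comb i j x y) = comb i j (- \<langle>\<alpha>v i,\<alpha> j\<rangle> * y - x) y"
  by (rule poly_mapping_eqI)
    (simp add: comb_def act_refl pairing_simps assms lookup_add lookup_minus algebra_simps)

lemma s_comb_right:
  assumes "j \<in> idx D"
  shows "act_root (s j) (comb i j x y) = comb i j x (- \<langle>\<alpha>v j,\<alpha> i\<rangle> * x - y)"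
  using s_comb_left[OF assms, of i y x] by (simp only: comb_swap[of i j])

lemma cartan_nonneg: "\<lbrakk>i \<in> idx D; j \<in> idx D; i \<noteq> j\<rbrakk> \<Longrightarrow> 0 \<le> - \<langle>\<alpha>v i,\<alpha> j\<rangle>"
  using cartan_nonpos by (simp add: pairing_simple)

lemma cartan_eq_0_iff: "\<lbrakk>i \<in> idx D; j \<in> idx D\<rbrakk> \<Longrightarrow> \<langle>\<alpha>v i,\<alpha> j\<rangle> = 0 \<longleftrightarrow> \<langle>\<alpha>v j,\<alpha> i\<rangle> = 0"
  using cartan_zero by (auto simp: pairing_simple)

text \<open>
  If \<open>a\<^sub>i\<^sub>j a\<^sub>j\<^sub>i \<ge> 4\<close>, the cone of \<open>x \<alpha>\<^sub>i + y \<alpha>\<^sub>j\<close> with \<open>0 \<le> y\<close> and \<open>- a\<^sub>i\<^sub>j y \<le> 2 x\<close> is mapped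
  by \<open>s\<^sub>j\<close> into the cone obtained by exchanging the roles of \<open>i\<close> and \<open>j\<close>.
\<close>

lemma altw_nonneg_infinite:
  assumes "i \<in> idx D" "j \<in> idx D" "i \<noteq> j" "\<langle>\<alpha>v i,\<alpha> j\<rangle> * \<langle>\<alpha>v j,\<alpha> i\<rangle> \<ge> 4"
    "0 \<le> y" "- \<langle>\<alpha>v i,\<alpha> j\<rangle> * y \<le> 2 * x"
  shows "\<exists>x'\<ge>0. \<exists>y'\<ge>0. act_root (val (altw n j i)) (comb i j x y) = comb i j x' y'"
  using assms
proof (induction n arbitrary: i j x y)
  case 0
  have "0 \<le> - \<langle>\<alpha>v i,\<alpha> j\<rangle> * y"
    using 0 cartan_nonneg by (intro mult_nonneg_nonneg) auto
  with 0 have "0 \<le> x" by linarith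
  with 0 show ?case by auto
next
  case (Suc n)
  define a b where "a = - \<langle>\<alpha>v i,\<alpha> j\<rangle>" and "b = - \<langle>\<alpha>v j,\<alpha> i\<rangle>"
  have ab: "a * b \<ge> 4" "a \<ge> 0" "b \<ge> 0"
    using Suc.prems cartan_nonneg unfolding a_def b_def by auto
  have y: "0 \<le> y" "a * y \<le> 2 * x" using Suc.prems unfolding a_def by auto
  have x: "0 \<le> x" using y mult_nonneg_nonneg[OF ab(2) y(1)] by linarith
  \<comment> \<open>Here \<open>s j\<close> replaces (x, y) by (x, b x - y). With the indices
    exchanged, the cone condition reads b x \<le> 2 (b x - y), which amounts to 4 y \<le> 2 b
    x.\<close>
  have "4 * y \<le> (a * b) * y" using ab y by (intro mult_right_mono) auto
  also have "\<dots> = b * (a * y)" by simp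
  also have "\<dots> \<le> b * (2 * x)" using ab y by (intro mult_left_mono) auto
  finally have "b * x \<le> 2 * (b * x - y)" by simp
  then have "- \<langle>\<alpha>v j,\<alpha> i\<rangle> * x \<le> 2 * (b * x - y)" by (simp add: b_def)
  then have "\<exists>x'\<ge>0. \<exists>y'\<ge>0. act_root (val (altw n i j)) (comb j i (b * x - y) x) = comb j i x' y'"
    using Suc.prems x by (intro Suc.IH) (auto simp: mult.commute)
  then show ?case
    using Suc.prems(2) by (simp add: s_comb_right b_def) (metis comb_swap)
qed

text \<open>The triples are the Cartan pairs with product below 4, together with the order m of
  \<open>s i \<cdot> s j\<close>. Each action is computed on an arbitrary vector plus x and y times
  the two simple (co)roots; the pairings p and r of that vector enter as parameters, so linear
  arithmetic in x and y decides each case.\<close>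

lemma braid_relation:
  assumes "i \<in> idx D" "j \<in> idx D"
    and "(\<langle>\<alpha>v i,\<alpha> j\<rangle>, \<langle>\<alpha>v j,\<alpha> i\<rangle>, m) \<in>
      {(0, 0, 2), (-1, -1, 3), (-1, -2, 4), (-2, -1, 4), (-1, -3, 6), (-3, -1, 6)}"
  shows "val (altw m j i) = val (altw m i j)"
proof (rule weyl_eqI)
  fix q
  define p r where "p = \<langle>\<alpha>v i,q\<rangle>" and "r = \<langle>\<alpha>v j,q\<rangle>"
  define R where "R x y = q + comb i j x y" for x y
  have R: "act_root (s i) (R x y) = R (- \<langle>\<alpha>v i,\<alpha> j\<rangle> * y - x - p) y"
    "act_root (s j) (R x y) = R x (- \<langle>\<alpha>v j,\<alpha> i\<rangle> * x - y - r)" for x y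
  proof -
    have "act_root (s i) (R x y) = (q - frag_cmul p (\<alpha> i)) + act_root (s i) (comb i j x y)"
      by (simp add: R_def act_root_add s_in_W assms p_def act_refl(1)[where q = q])
    also have "\<dots> = R (- \<langle>\<alpha>v i,\<alpha> j\<rangle> * y - x - p) y"
      unfolding s_comb_left[OF assms(1)] by (simp add: R_def comb_def frag_cmul_diff_distrib)
    finally show "act_root (s i) (R x y) = R (- \<langle>\<alpha>v i,\<alpha> j\<rangle> * y - x - p) y" .
    have "act_root (s j) (R x y) = (q - frag_cmul r (\<alpha> j)) + act_root (s j) (comb i j x y)"
      by (simp add: R_def act_root_add s_in_W assms r_def act_refl(1)[where q = q])
    also have "\<dots> = R x (- \<langle>\<alpha>v j,\<alpha> i\<rangle> * x - y - r)"
      unfolding s_comb_right[OF assms(2)] by (simp add: R_def comb_def frag_cmul_diff_distrib)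
    finally show "act_root (s j) (R x y) = R x (- \<langle>\<alpha>v j,\<alpha> i\<rangle> * x - y - r)" .
  qed
  have "act_root (val (altw m j i)) (R 0 0) = act_root (val (altw m i j)) (R 0 0)"
    using assms(3) by (auto simp: numeral_eq_Suc R algebra_simps)
  then show "act_root (val (altw m j i)) q = act_root (val (altw m i j)) q"
    by (simp add: R_def comb_def)
next
  fix \<mu>
  define p r where "p = \<langle>\<mu>,\<alpha> i\<rangle>" and "r = \<langle>\<mu>,\<alpha> j\<rangle>"
  define R where "R x y = \<mu> + zscale x (\<alpha>v i) + zscale y (\<alpha>v j)" for x y
  have R: "act_coweight (s i) (R x y) = R (- \<langle>\<alpha>v j,\<alpha> i\<rangle> * y - x - p) y"
    "act_coweight (s j) (R x y) = R x (- \<langle>\<alpha>v i,\<alpha> j\<rangle> * x - y - r)" for x y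
    using assms(1,2) unfolding R_def p_def r_def
    by (simp_all add: act_refl pairing_simps zscale_algebra zscale_mult_2 algebra_simps)
  have "act_coweight (val (altw m j i)) (R 0 0) = act_coweight (val (altw m i j)) (R 0 0)"
    using assms(3) by (auto simp: numeral_eq_Suc R algebra_simps)
  then show "act_coweight (val (altw m j i)) \<mu> = act_coweight (val (altw m i j)) \<mu>"
    by (simp add: R_def)
qed

text \<open>The bound n < m is sharp: the alternating word of length m is the longest element of the
  finite dihedral group and makes \<alpha> i negative.\<close>

lemma altw_nonneg_finite:
  assumes "i \<in> idx D" "j \<in> idx D"
    and "(\<langle>\<alpha>v i,\<alpha> j\<rangle>, \<langle>\<alpha>v j,\<alpha> i\<rangle>, m) \<in>
      {(0, 0, 2), (-1, -1, 3), (-1, -2, 4), (-2, -1, 4), (-1, -3, 6), (-3, -1, 6)}"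
  shows "\<forall>n<m. \<exists>x\<ge>0. \<exists>y\<ge>0. act_root (val (altw n j i)) (comb i j 1 0) = comb i j x y"
proof -
  note R = s_comb_left[OF assms(1), of j] s_comb_right[OF assms(2), of i]
  have *: "\<exists>x\<ge>0. \<exists>y\<ge>0. comb i j u v = comb i j x y" if "u \<ge> 0" "v \<ge> 0" for u v
    using that by blast
  show ?thesis
    using assms(3) by (elim insertE emptyE) (simp_all add: numeral_eq_Suc All_less_Suc R * del: One_nat_def)
qed

lemma rank_two_cases:
  assumes "i \<in> idx D" "j \<in> idx D" "i \<noteq> j"
  obtains "\<langle>\<alpha>v i,\<alpha> j\<rangle> * \<langle>\<alpha>v j,\<alpha> i\<rangle> \<ge> 4"
  | m where "(\<langle>\<alpha>v i,\<alpha> j\<rangle>, \<langle>\<alpha>v j,\<alpha> i\<rangle>, m) \<in>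
      {(0, 0, 2), (-1, -1, 3), (-1, -2, 4), (-2, -1, 4), (-1, -3, 6), (-3, -1, 6 :: nat)}"
proof -
  define a b where "a = - \<langle>\<alpha>v i,\<alpha> j\<rangle>" and "b = - \<langle>\<alpha>v j,\<alpha> i\<rangle>"
  have ab: "a \<ge> 0" "b \<ge> 0" "a = 0 \<longleftrightarrow> b = 0"
    using assms cartan_nonneg cartan_eq_0_iff unfolding a_def b_def by auto
  show ?thesis
  proof (cases "a * b \<ge> 4")
    case True
    then show ?thesis using that(1) by (simp add: a_def b_def)
  next
    case False
    have "a \<le> 3 \<and> b \<le> 3"
    proof (rule ccontr)
      assume "\<not> (a \<le> 3 \<and> b \<le> 3)"
      \<comment> \<open>One entry is at least 4, and the other is nonzero because a and b vanish
        together.\<close>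
      then have "a \<ge> 4 \<and> b \<ge> 1 \<or> a \<ge> 1 \<and> b \<ge> 4" using ab by linarith
      then have "4 * 1 \<le> a * b \<or> 1 * 4 \<le> a * b"
        using mult_mono[of 4 a 1 b] mult_mono[of 1 a 4 b] by linarith
      then show False using False by simp
    qed
    then have "a \<in> {0,1,2,3}" "b \<in> {0,1,2,3}" using ab by auto
    then have "(a, b) \<in> {(0,0),(1,1),(1,2),(2,1),(1,3),(3,1)}"
      using False ab(3) by auto
    then have "(\<langle>\<alpha>v i,\<alpha> j\<rangle>, \<langle>\<alpha>v j,\<alpha> i\<rangle>) \<in> {(0,0),(-1,-1),(-1,-2),(-2,-1),(-1,-3),(-3,-1)}"
      unfolding a_def b_def by auto
    then show ?thesis
      using that(2)[of 2] that(2)[of 3] that(2)[of 4] that(2)[of 6] by auto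
  qed
qed

text \<open>Failure to alternate produces two equal neighbours, which cancel in \<open>val\<close>.
  On the empty word \<open>hd\<close> is unspecified, but \<open>altw 0\<close> ignores its
  letters.\<close>

lemma not_alternating:
  assumes "set z \<subseteq> {i, j}" "z \<noteq> altw (length z) (hd z) (if hd z = i then j else i)"
  obtains u k v where "z = u @ [k, k] @ v" "k \<in> {i, j}"
proof -
  have "\<exists>u k v. z = u @ [k, k] @ v \<and> k \<in> {i, j}"
    using assms
  proof (induction z)
    case (Cons k z)
    show ?case
    proof (cases z)
      case Nil
      with Cons show ?thesis by simp
    next
      case (Cons l y)
      show ?thesis
      proof (cases "l = k")
        case True
        with Cons Cons.prems show ?thesis by (intro exI[of _ "[]"]) auto
      next
        case False
        then have "z \<noteq> altw (length z) (hd z) (if hd z = i then j else i)"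
          using Cons.prems \<open>z = l # y\<close> by (auto split: if_splits)
        then obtain u k' v where "z = u @ [k', k'] @ v" "k' \<in> {i, j}"
          using Cons.IH Cons.prems by auto
        then show ?thesis by (intro exI[of _ "k # u"]) auto
      qed
    qed
  qed simp
  then show ?thesis using that by blast
qed

lemma altw_split: "m \<le> n \<Longrightarrow> \<exists>v. altw n i j = altw m i j @ v \<and> length v = n - m \<and> set v \<subseteq> {i, j}"
proof (induction n arbitrary: m i j)
  case (Suc n)
  show ?case
  proof (cases m)
    case 0
    have "set (altw k i j) \<subseteq> {i, j} \<and> length (altw k i j) = k" for k i j
      by (induction k arbitrary: i j) auto
    with 0 show ?thesis by (metis altw.simps(1) append_Nil diff_zero)
  next
    case (Suc l)
    with Suc.IH[of l j i] Suc.prems show ?thesis by auto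
  qed
qed simp

text \<open>Repeated letters cancel, and a word that applies \<open>s i\<close> first is shortened
  by \<open>s i\<close> directly. What remains is an alternating word starting with j: it keeps
  \<alpha> i nonnegative if the dihedral group is infinite or the word is shorter than m; otherwise
  a braid relation makes it start with i.\<close>

lemma rank_two:
  assumes ij: "i \<in> idx D" "j \<in> idx D" "i \<noteq> j" and "set z \<subseteq> {i, j}"
  shows "(\<exists>x\<ge>0. \<exists>y\<ge>0. act_root (val z) (\<alpha> i) = comb i j x y) \<or>
    (\<exists>z'. set z' \<subseteq> {i, j} \<and> length z' < length z \<and> val z' = val z \<cdot> s i)"
  using assms(4)
proof (induction z rule: measure_induct_rule[where f = length])
  case (less z)
  have alt: "set (altw k l l') \<subseteq> {l, l'}" "length (altw k l l') = k" for k l l'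
    by (induction k arbitrary: l l') auto
  consider "z = []" | z2 where "z = i # z2" | n where "z = altw n j i"
    | u k v where "z = u @ [k, k] @ v" "k \<in> {i, j}"
  proof (cases "z = altw (length z) (hd z) (if hd z = i then j else i)")
    case True
    show thesis
    proof (cases z)
      case Nil
      then show thesis using that(1) by simp
    next
      case (Cons l z2)
      then show thesis using True less.prems that(2) that(3)[of "Suc (length z2)"] by (cases "l = i") auto
    qed
  next
    case False
    then show thesis using not_alternating[OF less.prems] that(4) by blast
  qed
  then show ?case
  proof cases
    case 1
    then have "act_root (val z) (\<alpha> i) = comb i j 1 0" by (simp add: comb_def)
    then show ?thesis by (metis order_refl zero_le_one)
  next
    case 2
    then show ?thesis using less.prems ij by (intro disjI2 exI[of _ z2]) auto
  next
    case 3
    have comb1: "\<alpha> i = comb i j 1 0" by (simp add: comb_def)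
    have length_z: "length z = n" using 3 alt by simp
    show ?thesis
    proof (rule rank_two_cases[OF ij])
      assume "\<langle>\<alpha>v i,\<alpha> j\<rangle> * \<langle>\<alpha>v j,\<alpha> i\<rangle> \<ge> 4"
      then have "\<exists>x\<ge>0. \<exists>y\<ge>0. act_root (val (altw n j i)) (comb i j 1 0) = comb i j x y"
        by (intro altw_nonneg_infinite ij) auto
      then show ?thesis using 3 comb1 by simp
    next
      fix m :: nat
      assume m: "(\<langle>\<alpha>v i,\<alpha> j\<rangle>, \<langle>\<alpha>v j,\<alpha> i\<rangle>, m) \<in>
        {(0, 0, 2), (-1, -1, 3), (-1, -2, 4), (-2, -1, 4), (-1, -3, 6), (-3, -1, 6)}"
      show ?thesis
      proof (cases "length z < m")
        case True
        then show ?thesis using altw_nonneg_finite[OF ij(1,2) m] 3 comb1 length_z by simp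
      next
        case False
        then obtain v where v: "altw n j i = altw m j i @ v" "set v \<subseteq> {j, i}"
          "length v = n - m"
          using altw_split[of m n j i] length_z by auto
        from m obtain l where l: "m = Suc l" by (cases m) auto
        \<comment> \<open>The prefix j, i, ... of length m is traded for i, j, ...; its first letter
          is then cancelled by \<open>s i\<close>, leaving m - 1 letters before v.\<close>
        have "val z = val v \<cdot> val (altw m i j)"
          using 3 v braid_relation[OF ij(1,2) m] by (simp add: val_append)
        then have "val z \<cdot> s i = val (altw l j i @ v)"
          using ij by (simp add: l val_append wmult_assoc)
        moreover have "length (altw l j i @ v) < length z" "set (altw l j i @ v) \<subseteq> {i, j}"
          using v l False alt(1)[of l j i] alt(2) length_z by auto
        ultimately show ?thesis by (intro disjI2 exI[of _ "altw l j i @ v"]) simp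
      qed
    qed
  next
    case 4
    then have "val (u @ v) = val z" using ij by (auto simp: val_append wmult_assoc)
    moreover have "length (u @ v) < length z" "set (u @ v) \<subseteq> {i, j}" using 4 less.prems by auto
    ultimately show ?thesis using less.IH[of "u @ v"] by (metis less_trans)
  qed
qed

section \<open>Real roots and inversions\<close>

text \<open>Unlike \<open>pos_roots\<close>, this notion does not ask for a root and is closed under
  nonnegative combinations.\<close>

definition nonneg :: "'i root \<Rightarrow> bool"
  where "nonneg q \<longleftrightarrow> (\<forall>k. 0 \<le> Poly_Mapping.lookup q k)"

lemma nonneg_simple: "nonneg (\<alpha> i)"
  by (simp add: nonneg_def)

lemma nonneg_cmul_add: "\<lbrakk>nonneg p; nonneg q; 0 \<le> x; 0 \<le> y\<rbrakk> \<Longrightarrow> nonneg (frag_cmul x p + frag_cmul y q)"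
  by (simp add: nonneg_def lookup_add)

lemma nonneg_diff_cmul: "nonneg (p - frag_cmul c q) \<longleftrightarrow> nonneg (p + frag_cmul (- c) q)"
  by (simp add: nonneg_def lookup_add lookup_minus)

text \<open>
  Tits' argument: split \<open>w = v z\<close> with \<open>z\<close> in the subgroup generated by \<open>s\<^sub>i\<close> and \<open>s\<^sub>j\<close>, where \<open>j\<close>
  ends a reduced word of \<open>w\<close> and \<open>v\<close> is as short as possible.
\<close>

lemma nonneg_or_wlen_less:
  assumes "w \<in> W" "i \<in> idx D"
  shows "nonneg (act_root w (\<alpha> i)) \<or> wlen (w \<cdot> s i) < wlen w"
  using assms
proof (induction w arbitrary: i rule: measure_induct_rule[where f = wlen])
  case (less w i)
  obtain xs where xs: "set xs \<subseteq> idx D" "val xs = w" "length xs = wlen w"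
    using reduced_word[OF less.prems(1)] .
  show ?case
  proof (cases xs)
    case Nil
    then show ?thesis using xs by (simp add: nonneg_simple)
  next
    case (Cons j ys)
    show ?thesis
    proof (cases "j = i")
      case True
      then have "w \<cdot> s i = val ys" using Cons xs less.prems(2) by auto
      then show ?thesis using wlen_le[of ys] Cons xs by simp
    next
      case False
      have j: "j \<in> idx D" using Cons xs by simp
      define P where "P n \<longleftrightarrow> (\<exists>v\<in>W. \<exists>z. set z \<subseteq> {i, j} \<and> w = v \<cdot> val z \<and>
        wlen v + length z \<le> wlen w \<and> wlen v = n)" for n
      have "wlen (val ys) + length [j] \<le> wlen w"
        using wlen_le[of ys] Cons xs by simp
      moreover have "w = val ys \<cdot> val [j]" "val ys \<in> W"
        using Cons xs by (auto intro: val_in_W)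
      ultimately have P: "P (wlen (val ys))"
        unfolding P_def by (intro bexI[of _ "val ys"] exI[of _ "[j]"]) auto
      define n where "n = (LEAST n. P n)"
      have "P n" "n \<le> wlen (val ys)"
        unfolding n_def using P by (auto intro: LeastI Least_le)
      then obtain v z where v: "v \<in> W" "set z \<subseteq> {i, j}" "w = v \<cdot> val z"
        "wlen v + length z \<le> wlen w" "wlen v = n"
        unfolding P_def by blast
      \<comment> \<open>The choice z = [j] already leaves a factor shorter than w, so the minimal v
        is shorter too and the induction hypothesis applies to it.\<close>
      have "wlen v < wlen w"
        using v \<open>n \<le> _\<close> wlen_le[of ys] Cons xs by simp
      \<comment> \<open>Otherwise \<open>s k\<close> could be moved from v to z: v gets shorter by
        at least one and z longer by one, contradicting the minimality of v.\<close>
      have vk: "nonneg (act_root v (\<alpha> k))" if k: "k \<in> {i, j}" for k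
      proof (rule ccontr)
        have "k \<in> idx D" using k j less.prems(2) by auto
        assume *: "\<not> nonneg (act_root v (\<alpha> k))"
        have shorter: "wlen (v \<cdot> s k) < wlen v"
          using less.IH[OF \<open>wlen v < wlen w\<close> v(1) \<open>k \<in> idx D\<close>] * by simp
        have "w = v \<cdot> s k \<cdot> val (z @ [k])"
          using v \<open>k \<in> idx D\<close> by (simp add: val_append wmult_assoc)
        then have "P (wlen (v \<cdot> s k))"
          unfolding P_def using shorter v k \<open>k \<in> idx D\<close>
          by (intro bexI[of _ "v \<cdot> s k"] exI[of _ "z @ [k]"]) (auto intro: wmult_in_W s_in_W)
        then have "n \<le> wlen (v \<cdot> s k)" unfolding n_def by (rule Least_le)
        then show False using shorter v by simp
      qed
      consider x y where "x \<ge> 0" "y \<ge> 0" "act_root (val z) (\<alpha> i) = comb i j x y"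
        | z' where "set z' \<subseteq> {i, j}" "length z' < length z" "val z' = val z \<cdot> s i"
        using rank_two[OF less.prems(2) j _ v(2)] False by blast
      then show ?thesis
      proof cases
        case 1
        then show ?thesis using vk v by (simp add: act_comb nonneg_cmul_add)
      next
        case 2
        then have "w \<cdot> s i = v \<cdot> val z'" using v by (simp add: wmult_assoc)
        moreover have "wlen (v \<cdot> val z') \<le> wlen v + length z'"
          using 2 j less.prems(2) by (intro wlen_append v) auto
        ultimately show ?thesis using 2 v by simp
      qed
    qed
  qed
qed

lemma act_s_simple [simp]:
  assumes "i \<in> idx D"
  shows "act_root (s i) (\<alpha> i) = - \<alpha> i" "act_coweight (s i) (\<alpha>v i) = - \<alpha>v i"
  using assms by (simp_all add: act_refl frag_cmul_eq_zscale zscale_2)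

text \<open>The elements w and \<open>w \<cdot> s i\<close> send \<alpha> i to opposite vectors, and
  each is the other one times \<open>s i\<close>, so multiplication by \<open>s i\<close> cannot
  shorten both.\<close>

lemma nonneg_or_nonneg_minus:
  assumes "w \<in> W" "i \<in> idx D"
  shows "nonneg (act_root w (\<alpha> i)) \<or> nonneg (- act_root w (\<alpha> i))"
proof (rule disjCI)
  assume "\<not> nonneg (- act_root w (\<alpha> i))"
  moreover have "act_root (w \<cdot> s i) (\<alpha> i) = - act_root w (\<alpha> i)"
    using assms by (simp add: act_simps)
  ultimately have "wlen w < wlen (w \<cdot> s i)"
    using nonneg_or_wlen_less[of "w \<cdot> s i" i] assms by (simp add: wmult_in_W s_in_W)
  then show "nonneg (act_root w (\<alpha> i))" using nonneg_or_wlen_less[OF assms] by simp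
qed

abbreviation Pos where "Pos \<equiv> pos_roots D"

abbreviation Neg where "Neg \<equiv> neg_roots D"

abbreviation Roots where "Roots \<equiv> real_roots D"

lemma RootsI: "\<lbrakk>w \<in> W; i \<in> idx D\<rbrakk> \<Longrightarrow> act_root w (\<alpha> i) \<in> Roots"
  unfolding real_roots_def by blast

lemma Roots_cases:
  assumes "\<beta> \<in> Roots"
  obtains w i where "w \<in> W" "i \<in> idx D" "\<beta> = act_root w (\<alpha> i)"
  using assms unfolding real_roots_def by blast

lemma simple_in_Roots: "i \<in> idx D \<Longrightarrow> \<alpha> i \<in> Roots"
  using RootsI[OF e_in_W] by simp

lemma act_in_Roots: "\<lbrakk>\<beta> \<in> Roots; w \<in> W\<rbrakk> \<Longrightarrow> act_root w \<beta> \<in> Roots"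
  by (metis Roots_cases RootsI act_wmult(1) wmult_in_W)

lemma minus_in_Roots:
  assumes "\<beta> \<in> Roots"
  shows "- \<beta> \<in> Roots"
proof -
  obtain w i where w: "w \<in> W" "i \<in> idx D" "\<beta> = act_root w (\<alpha> i)" using Roots_cases[OF assms] .
  then have "act_root (w \<cdot> s i) (\<alpha> i) = - \<beta>"
    by (simp add: act_simps)
  then show ?thesis using w act_in_Roots[OF simple_in_Roots wmult_in_W[OF _ s_in_W]] by metis
qed

lemma Roots_nonzero:
  assumes "\<beta> \<in> Roots"
  shows "\<beta> \<noteq> 0"
proof
  obtain w i where w: "w \<in> W" "i \<in> idx D" "\<beta> = act_root w (\<alpha> i)" using Roots_cases[OF assms] .
  assume "\<beta> = 0"
  then have "act_root (winv w) \<beta> = 0" using w by (simp add: act_simps winv_in_W)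
  then show False using w by (simp add: act_winv)
qed

lemma Pos_iff: "\<beta> \<in> Pos \<longleftrightarrow> \<beta> \<in> Roots \<and> nonneg \<beta>"
  by (simp add: pos_roots_def nonneg_def)

lemma Neg_iff: "\<beta> \<in> Neg \<longleftrightarrow> - \<beta> \<in> Pos"
  unfolding neg_roots_def by (metis (no_types, lifting) image_iff minus_minus)

lemma not_Pos_and_Neg: "\<lbrakk>\<beta> \<in> Pos; - \<beta> \<in> Pos\<rbrakk> \<Longrightarrow> False"
proof -
  assume "\<beta> \<in> Pos" "- \<beta> \<in> Pos"
  then have "\<beta> \<in> Roots" "nonneg \<beta>" "nonneg (- \<beta>)" by (simp_all add: Pos_iff)
  then have "Poly_Mapping.lookup \<beta> k = 0" for k
    unfolding nonneg_def lookup_uminus by (metis antisym neg_0_le_iff_le)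
  then have "\<beta> = 0" by (intro poly_mapping_eqI) simp
  then show False using Roots_nonzero[OF \<open>\<beta> \<in> Roots\<close>] by simp
qed

lemma Roots_Pos_or_Neg: "\<beta> \<in> Roots \<Longrightarrow> \<beta> \<in> Pos \<or> - \<beta> \<in> Pos"
proof -
  assume \<beta>: "\<beta> \<in> Roots"
  then obtain w i where "w \<in> W" "i \<in> idx D" "\<beta> = act_root w (\<alpha> i)" using Roots_cases by blast
  then show ?thesis
    using nonneg_or_nonneg_minus[of w i] \<beta> minus_in_Roots[OF \<beta>] by (simp add: Pos_iff)
qed

lemma Neg_iff_not_Pos: "\<beta> \<in> Roots \<Longrightarrow> \<beta> \<in> Neg \<longleftrightarrow> \<beta> \<notin> Pos"
  using Roots_Pos_or_Neg not_Pos_and_Neg by (auto simp: Neg_iff)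

lemma Pos_in_Roots: "\<beta> \<in> Pos \<Longrightarrow> \<beta> \<in> Roots"
  by (simp add: Pos_iff)

lemma act_Pos_or_Neg: "\<lbrakk>\<beta> \<in> Pos; w \<in> W\<rbrakk> \<Longrightarrow> act_root w \<beta> \<in> Neg \<longleftrightarrow> act_root w \<beta> \<notin> Pos"
  by (simp add: Neg_iff_not_Pos act_in_Roots Pos_in_Roots)

lemma simple_in_Pos: "i \<in> idx D \<Longrightarrow> \<alpha> i \<in> Pos"
  by (simp add: Pos_iff simple_in_Roots nonneg_simple)

text \<open>Real roots are primitive vectors, so \<open>\<alpha>\<^sub>i\<close> is the only positive one proportional to \<open>\<alpha>\<^sub>i\<close>.\<close>

lemma Pos_other_coefficient:
  assumes "\<beta> \<in> Pos" "i \<in> idx D" "\<beta> \<noteq> \<alpha> i"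
  obtains k where "k \<noteq> i" "0 < Poly_Mapping.lookup \<beta> k"
proof (rule ccontr)
  assume *: "\<not> thesis"
  have nn: "0 \<le> Poly_Mapping.lookup \<beta> k" for k using assms by (simp add: Pos_iff nonneg_def)
  have "Poly_Mapping.lookup \<beta> k = 0" if "k \<noteq> i" for k
    using * that nn[of k] \<open>\<And>k. \<lbrakk>k \<noteq> i; 0 < Poly_Mapping.lookup \<beta> k\<rbrakk> \<Longrightarrow> thesis\<close> by fastforce
  then have c: "\<beta> = frag_cmul (Poly_Mapping.lookup \<beta> i) (\<alpha> i)"
    by (intro poly_mapping_eqI) auto
  obtain w j where w: "w \<in> W" "j \<in> idx D" "\<beta> = act_root w (\<alpha> j)"
    using Roots_cases[OF Pos_in_Roots[OF assms(1)]] .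
  define q where "q = act_root (winv w) (\<alpha> i)"
  \<comment> \<open>Pulled back by w, a simple root becomes an integral multiple of a lattice
    vector, so the multiplier is a unit.\<close>
  have "\<alpha> j = act_root (winv w) \<beta>" using w by (simp add: act_winv)
  also have "\<dots> = frag_cmul (Poly_Mapping.lookup \<beta> i) q"
    using c w by (metis act_root_cmul winv_in_W q_def)
  finally have "Poly_Mapping.lookup (\<alpha> j) j = Poly_Mapping.lookup \<beta> i * Poly_Mapping.lookup q j"
    by (simp only: lookup_frag_cmul)
  then have "Poly_Mapping.lookup \<beta> i * Poly_Mapping.lookup q j = 1" by simp
  then have "Poly_Mapping.lookup \<beta> i = 1"
    using nn[of i] by (auto simp: zmult_eq_1_iff)
  then show False using c assms(3) by simp
qed

text \<open>By sign-coherence a single positive coefficient decides the sign of a root.\<close>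

lemma Pos_if_coefficient: "\<lbrakk>\<beta> \<in> Roots; 0 < Poly_Mapping.lookup \<beta> k\<rbrakk> \<Longrightarrow> \<beta> \<in> Pos"
  using Roots_Pos_or_Neg[of \<beta>] by (force simp: Pos_iff nonneg_def not_le[symmetric])

text \<open>The reflection changes only the coefficient at i, so some other positive coefficient
  survives.\<close>

lemma s_permutes_Pos:
  assumes "\<beta> \<in> Pos" "i \<in> idx D" "\<beta> \<noteq> \<alpha> i"
  shows "act_root (s i) \<beta> \<in> Pos"
proof -
  obtain k where k: "k \<noteq> i" "0 < Poly_Mapping.lookup \<beta> k" using Pos_other_coefficient[OF assms] .
  then have "0 < Poly_Mapping.lookup (act_root (s i) \<beta>) k"
    by (simp add: act_refl lookup_minus)
  then show ?thesis
    using assms Pos_if_coefficient act_in_Roots by (simp add: s_in_W Pos_in_Roots)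
qed

lemma s_Pos_iff:
  assumes "\<beta> \<in> Roots" "i \<in> idx D"
  shows "act_root (s i) \<beta> \<in> Pos \<longleftrightarrow> \<beta> \<in> Pos \<and> \<beta> \<noteq> \<alpha> i \<or> \<beta> = - \<alpha> i"
proof (cases "\<beta> \<in> Pos")
  case True
  then show ?thesis
    using assms s_permutes_Pos[of \<beta> i] not_Pos_and_Neg[OF simple_in_Pos[OF assms(2)]]
    by (cases "\<beta> = \<alpha> i") auto
next
  case False
  then have neg: "- \<beta> \<in> Pos" using assms Roots_Pos_or_Neg by blast
  show ?thesis
  proof (cases "\<beta> = - \<alpha> i")
    case True
    then show ?thesis using assms by (simp add: act_simps s_in_W simple_in_Pos)
  next
    case neq: False
    then have "- \<beta> \<noteq> \<alpha> i" by (metis minus_minus)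
    then have "- act_root (s i) \<beta> \<in> Pos"
      using s_permutes_Pos[OF neg assms(2)] assms by (auto simp: act_simps s_in_W)
    then show ?thesis using False neq not_Pos_and_Neg by blast
  qed
qed

section \<open>Inversion sets and the inversion count\<close>

abbreviation Inv where "Inv \<equiv> inversions D"

lemma Inv_iff: "w \<in> W \<Longrightarrow> \<gamma> \<in> Inv w \<longleftrightarrow> \<gamma> \<in> Pos \<and> - act_root w \<gamma> \<in> Pos"
  by (simp add: inversions_def Neg_iff)

lemma Inv_iff_not_Pos: "w \<in> W \<Longrightarrow> \<gamma> \<in> Inv w \<longleftrightarrow> \<gamma> \<in> Pos \<and> act_root w \<gamma> \<notin> Pos"
  by (auto simp: inversions_def act_Pos_or_Neg)

lemma Inv_e [simp]: "Inv e = {}"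
  by (auto simp: Inv_iff_not_Pos e_in_W)

lemma Inv_s: "i \<in> idx D \<Longrightarrow> Inv (s i) = {\<alpha> i}"
proof (intro set_eqI iffI)
  fix \<gamma> assume i: "i \<in> idx D"
  {
    assume "\<gamma> \<in> Inv (s i)"
    then show "\<gamma> \<in> {\<alpha> i}" using s_permutes_Pos[OF _ i] i by (auto simp: Inv_iff_not_Pos s_in_W)
  next
    assume "\<gamma> \<in> {\<alpha> i}"
    then show "\<gamma> \<in> Inv (s i)" using i by (simp add: Inv_iff s_in_W simple_in_Pos)
  }
qed

text \<open>A root that ends up negative turns negative either under w or afterwards under v. This
  gives finiteness of inversion sets and subadditivity of \<open>len\<close>.\<close>

lemma Inv_wmult_subset:
  assumes "v \<in> W" "w \<in> W"
  shows "Inv (v \<cdot> w) \<subseteq> Inv w \<union> act_root (winv w) ` Inv v"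
proof
  fix \<gamma> assume "\<gamma> \<in> Inv (v \<cdot> w)"
  then have \<gamma>: "\<gamma> \<in> Pos" "act_root v (act_root w \<gamma>) \<notin> Pos"
    using assms by (auto simp: Inv_iff_not_Pos wmult_in_W)
  show "\<gamma> \<in> Inv w \<union> act_root (winv w) ` Inv v"
  proof (cases "act_root w \<gamma> \<in> Pos")
    case True
    then have "act_root w \<gamma> \<in> Inv v" using \<gamma> assms by (simp add: Inv_iff_not_Pos)
    then have "act_root (winv w) (act_root w \<gamma>) \<in> act_root (winv w) ` Inv v" by (rule imageI)
    then show ?thesis using assms by (simp add: act_winv)
  next
    case False
    then show ?thesis using \<gamma> assms by (simp add: Inv_iff_not_Pos)
  qed
qed

lemma finite_Inv:
  assumes "w \<in> W"
  shows "finite (Inv w)"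
  using assms
proof induction
  case one
  show ?case unfolding e_def[symmetric] by simp
next
  case (simple i w)
  show ?case
    using simple
    by (intro finite_subset[OF Inv_wmult_subset]) (simp_all add: Inv_s s_in_W)
qed

definition len :: "('i, 'p) weyl \<Rightarrow> nat"
  where "len w = card (Inv w)"

lemma len_wmult_le:
  assumes "v \<in> W" "w \<in> W"
  shows "len (v \<cdot> w) \<le> len v + len w"
proof -
  have "len (v \<cdot> w) \<le> card (Inv w \<union> act_root (winv w) ` Inv v)"
    unfolding len_def using assms by (intro card_mono Inv_wmult_subset) (auto intro: finite_Inv)
  also have "\<dots> \<le> len w + card (act_root (winv w) ` Inv v)"
    unfolding len_def by (rule card_Un_le)
  also have "card (act_root (winv w) ` Inv v) \<le> len v"
    unfolding len_def by (intro card_image_le finite_Inv assms)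
  finally show ?thesis by simp
qed

lemma Inv_winv:
  assumes "w \<in> W"
  shows "Inv (winv w) = (\<lambda>\<gamma>. - act_root w \<gamma>) ` Inv w"
proof (intro set_eqI iffI)
  fix \<gamma> assume "\<gamma> \<in> Inv (winv w)"
  then have "- act_root (winv w) \<gamma> \<in> Inv w" "\<gamma> = - act_root w (- act_root (winv w) \<gamma>)"
    using assms by (simp_all add: Inv_iff winv_in_W act_simps act_winv)
  then show "\<gamma> \<in> (\<lambda>\<gamma>. - act_root w \<gamma>) ` Inv w" by blast
next
  fix \<gamma> assume "\<gamma> \<in> (\<lambda>\<gamma>. - act_root w \<gamma>) ` Inv w"
  then show "\<gamma> \<in> Inv (winv w)"
    using assms by (auto simp: Inv_iff winv_in_W act_simps act_winv)
qed

lemma inj_act_root: "w \<in> W \<Longrightarrow> inj (act_root w)"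
  by (metis injI act_winv(1))

lemma len_winv [simp]:
  assumes "w \<in> W"
  shows "len (winv w) = len w"
proof -
  have "inj (\<lambda>\<gamma>. - act_root w \<gamma>)"
    using inj_act_root[OF assms] by (simp add: inj_def)
  then show ?thesis
    unfolding len_def Inv_winv[OF assms] by (intro card_image) (auto intro: inj_on_subset)
qed

text \<open>Let \<eta> be the positive one of v \<gamma> and - v \<gamma>. Then \<gamma> is an
  inversion of \<open>winv w \<cdot> v\<close> exactly when just one of \<open>winv v\<close>,
  \<open>winv w\<close> makes \<eta> negative. Up to signs and \<open>winv v\<close>, the inversions
  thus form a symmetric difference.\<close>

lemma Inv_winv_wmult:
  assumes "v \<in> W" "w \<in> W"
  shows "Inv (winv w \<cdot> v) = act_root (winv v) ` (Inv (winv w) - Inv (winv v)) \<union>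
    (\<lambda>\<gamma>. - act_root (winv v) \<gamma>) ` (Inv (winv v) - Inv (winv w))" (is "_ = ?R")
proof (intro set_eqI iffI)
  fix \<gamma> assume "\<gamma> \<in> Inv (winv w \<cdot> v)"
  then have \<gamma>: "\<gamma> \<in> Pos" "- act_root (winv w) (act_root v \<gamma>) \<in> Pos"
    using assms by (simp_all add: Inv_iff wmult_in_W winv_in_W)
  show "\<gamma> \<in> ?R"
  proof (cases "act_root v \<gamma> \<in> Pos")
    case True
    then have "act_root v \<gamma> \<in> Inv (winv w)" using \<gamma> assms by (simp add: Inv_iff winv_in_W)
    moreover have "act_root v \<gamma> \<notin> Inv (winv v)"
      using \<gamma> assms by (simp add: Inv_iff_not_Pos winv_in_W act_winv)
    moreover have "\<gamma> = act_root (winv v) (act_root v \<gamma>)" using assms by (simp add: act_winv)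
    ultimately show ?thesis by blast
  next
    case False
    then have "- act_root v \<gamma> \<in> Pos" using \<gamma> assms Roots_Pos_or_Neg act_in_Roots Pos_in_Roots by blast
    then have "- act_root v \<gamma> \<in> Inv (winv v)"
      using \<gamma> assms by (simp add: Inv_iff winv_in_W act_simps act_winv)
    moreover have "- act_root v \<gamma> \<notin> Inv (winv w)"
      using \<gamma> assms by (simp add: Inv_iff_not_Pos winv_in_W act_simps)
    moreover have "\<gamma> = - act_root (winv v) (- act_root v \<gamma>)"
      using assms by (simp add: act_winv act_simps winv_in_W)
    ultimately show ?thesis by blast
  qed
next
  fix \<gamma> assume "\<gamma> \<in> ?R"
  then consider \<eta> where "\<gamma> = act_root (winv v) \<eta>" "\<eta> \<in> Inv (winv w)" "\<eta> \<notin> Inv (winv v)"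
    | \<eta> where "\<gamma> = - act_root (winv v) \<eta>" "\<eta> \<in> Inv (winv v)" "\<eta> \<notin> Inv (winv w)"
    by blast
  then show "\<gamma> \<in> Inv (winv w \<cdot> v)"
  proof cases
    case 1
    then have "- act_root (winv w) \<eta> \<in> Pos" "\<eta> \<in> Pos" using assms by (simp_all add: Inv_iff winv_in_W)
    moreover from this have "\<gamma> \<in> Pos" using 1 assms by (simp add: Inv_iff_not_Pos winv_in_W)
    ultimately show ?thesis using 1 assms by (simp add: Inv_iff wmult_in_W winv_in_W act_winv)
  next
    case 2
    then have "\<gamma> \<in> Pos" "\<eta> \<in> Pos" using assms by (simp_all add: Inv_iff winv_in_W)
    moreover from this have "act_root (winv w) \<eta> \<in> Pos"
      using 2 assms by (simp add: Inv_iff_not_Pos winv_in_W)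
    ultimately show ?thesis using 2 assms by (simp add: Inv_iff wmult_in_W winv_in_W act_winv act_simps)
  qed
qed

text \<open>This expresses \<open>len\<close> of a quotient through the set
  \<open>Inv (winv w)\<close> over which \<open>aff_length\<close> counts.\<close>

lemma len_winv_wmult:
  assumes "v \<in> W" "w \<in> W"
  shows "len (winv v \<cdot> w) = card (Inv (winv w) - Inv (winv v)) + card (Inv (winv v) - Inv (winv w))"
proof -
  have "winv (winv v \<cdot> w) = winv w \<cdot> v"
    using assms by (simp add: winv_wmult_distrib winv_in_W winv_winv)
  then have "len (winv v \<cdot> w) = card (Inv (winv w \<cdot> v))"
    using len_winv[of "winv v \<cdot> w"] assms by (simp add: wmult_in_W winv_in_W) (simp add: len_def)
  also have "\<dots> = card (act_root (winv v) ` (Inv (winv w) - Inv (winv v))) +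
      card ((\<lambda>\<gamma>. - act_root (winv v) \<gamma>) ` (Inv (winv v) - Inv (winv w)))"
    unfolding Inv_winv_wmult[OF assms]
  proof (rule card_Un_disjoint)
    show "act_root (winv v) ` (Inv (winv w) - Inv (winv v)) \<inter>
        (\<lambda>\<gamma>. - act_root (winv v) \<gamma>) ` (Inv (winv v) - Inv (winv w)) = {}"
    proof (intro equals0I, elim IntE imageE)
      fix \<gamma> a b
      assume *: "\<gamma> = act_root (winv v) a" "a \<in> Inv (winv w) - Inv (winv v)"
        "\<gamma> = - act_root (winv v) b" "b \<in> Inv (winv v) - Inv (winv w)"
      then have "act_root (winv v) a = act_root (winv v) (- b)"
        using assms by (simp add: act_simps winv_in_W)
      then have "a = - b" using inj_act_root[OF winv_in_W[OF assms(1)]] by (simp add: inj_eq)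
      then show False using * assms not_Pos_and_Neg[of b] by (simp add: Inv_iff winv_in_W)
    qed
  qed (simp_all add: assms finite_Inv winv_in_W)
  also have "\<dots> = card (Inv (winv w) - Inv (winv v)) + card (Inv (winv v) - Inv (winv w))"
  proof -
    have inj: "inj (act_root (winv v))" using inj_act_root[OF winv_in_W[OF assms(1)]] .
    then have "inj (\<lambda>\<gamma>. - act_root (winv v) \<gamma>)" by (simp add: inj_def)
    with inj show ?thesis by (simp add: card_image inj_on_subset[OF _ subset_UNIV])
  qed
  finally show ?thesis .
qed

text \<open>If a reduced word of w starts with i, then \<open>w \<cdot> s i\<close> is shorter than
  w, so the length dichotomy for \<open>w \<cdot> s i\<close> makes \<alpha> i an inversion of
  w.\<close>

lemma eq_e_if_Inv_empty:
  assumes "w \<in> W" "Inv w = {}"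
  shows "w = e"
proof -
  obtain xs where xs: "set xs \<subseteq> idx D" "val xs = w" "length xs = wlen w"
    using reduced_word[OF assms(1)] .
  show ?thesis
  proof (cases xs)
    case Nil
    then show ?thesis using xs by simp
  next
    case (Cons i ys)
    then have i: "i \<in> idx D" using xs by simp
    have ws: "w \<cdot> s i = val ys" using Cons xs i by auto
    then have "wlen (w \<cdot> s i) < wlen w" using wlen_le[of ys] Cons xs by simp
    moreover have ys: "val ys \<in> W" using xs Cons by (intro val_in_W) simp
    moreover have "val ys \<cdot> s i = w" using ws i by (metis wmult_s_s)
    ultimately have "nonneg (act_root (w \<cdot> s i) (\<alpha> i))"
      using nonneg_or_wlen_less[OF ys i] ws by auto
    then have "- act_root w (\<alpha> i) \<in> Pos"
      using i assms by (simp add: Pos_iff act_simps minus_in_Roots act_in_Roots simple_in_Roots)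
    then have "\<alpha> i \<in> Inv w" using i assms(1) by (simp add: Inv_iff simple_in_Pos)
    then show ?thesis using assms by simp
  qed
qed

section \<open>Coroots and reflections\<close>

lemma coweight_torsion_free:
  fixes x :: 'p
  assumes "zscale 2 x = 0"
  shows "x = 0"
proof -
  obtain B :: "'p set" where B: "zmod.independent B" "zmod.span B = UNIV"
    using coweight_lattice by blast
  have "zmod.representation B (zscale 2 x) = (\<lambda>b. 2 * zmod.representation B x b)"
    using B by (intro zmod.representation_scale) auto
  then have "2 * zmod.representation B x b = 0" for b
    unfolding assms zmod.representation_zero by metis
  then have "{b. zmod.representation B x b \<noteq> 0} = {}" by simp
  then show ?thesis
    using zmod.sum_nonzero_representation_eq[OF B(1), of x] B(2) by simp
qed

lemma refl_conj:
  assumes "w \<in> W"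
  shows "w \<cdot> refl_of D \<beta> \<mu> = refl_of D (act_root w \<beta>) (act_coweight w \<mu>) \<cdot> w"
  by (rule weyl_eqI)
    (simp_all add: act_refl act_simps assms pairing_act_left pairing_act_right act_winv)

text \<open>
  If \<open>u \<alpha>\<^sub>i = \<alpha>\<^sub>j\<close>, then \<open>s\<^sub>j u s\<^sub>i u\<^sup>-\<^sup>1\<close> moves every root by a multiple of \<open>\<alpha>\<^sub>j\<close> and fixes \<open>\<alpha>\<^sub>j\<close>, so it
  has no inversions and is trivial.
\<close>

lemma simple_coroot_conj:
  assumes "u \<in> W" "i \<in> idx D" "j \<in> idx D" "act_root u (\<alpha> i) = \<alpha> j"
  shows "act_coweight u (\<alpha>v i) = \<alpha>v j"
proof -
  define \<mu> where "\<mu> = act_coweight u (\<alpha>v i)"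
  define r where "r = refl_of D (\<alpha> j) \<mu>"
  have r: "u \<cdot> s i = r \<cdot> u" using refl_conj[OF assms(1), of "\<alpha> i" "\<alpha>v i"] assms by (simp add: r_def \<mu>_def)
  then have "r = u \<cdot> s i \<cdot> winv u" using assms by (simp add: winv_cancel)
  then have rW: "r \<in> W" using assms by (simp add: wmult_in_W s_in_W winv_in_W)
  have "\<langle>\<mu>,\<alpha> j\<rangle> = 2"
    using pairing_invariant[OF assms(1), of "\<alpha>v i" "\<alpha> i"] assms by (simp add: \<mu>_def)
  then have rj: "act_root r (\<alpha> j) = - \<alpha> j"
    by (simp add: r_def act_refl frag_cmul_eq_zscale zscale_2)
  have "Inv (s j \<cdot> r) = {}"
  proof (intro equals0I)
    fix \<gamma> assume "\<gamma> \<in> Inv (s j \<cdot> r)"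
    then have \<gamma>: "\<gamma> \<in> Pos" "act_root (s j \<cdot> r) \<gamma> \<notin> Pos"
      using rW assms by (simp_all add: Inv_iff_not_Pos wmult_in_W s_in_W)
    show False
    proof (cases "\<gamma> = \<alpha> j")
      case True
      then show False using \<gamma> rj assms by (simp add: act_simps s_in_W)
    next
      case False
      obtain k where k: "k \<noteq> j" "0 < Poly_Mapping.lookup \<gamma> k"
        using Pos_other_coefficient[OF \<gamma>(1) assms(3) False] .
      then have "0 < Poly_Mapping.lookup (act_root (s j \<cdot> r) \<gamma>) k"
        by (simp add: act_refl r_def lookup_minus)
      moreover have "act_root (s j \<cdot> r) \<gamma> \<in> Roots"
        using rW \<gamma> assms by (intro act_in_Roots Pos_in_Roots wmult_in_W s_in_W)
      ultimately show False using Pos_if_coefficient \<gamma> by blast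
    qed
  qed
  then have "s j \<cdot> r = e" using rW assms by (intro eq_e_if_Inv_empty wmult_in_W s_in_W)
  then have "s j = r" using assms by (metis s_s wmult_assoc wmult_e)
  \<comment> \<open>Equal reflections determine the coroot only up to a factor 2; freeness of the
    coweight lattice removes it.\<close>
  then have "act_coweight (s j) (\<alpha>v j) = act_coweight r (\<alpha>v j)" by simp
  then have "zscale 2 (\<alpha>v j - \<mu>) = 0"
    using assms(3) by (simp add: r_def act_refl(2) zmod.scale_right_diff_distrib del: act_s_simple)
  then have "\<alpha>v j - \<mu> = 0" by (rule coweight_torsion_free)
  then show ?thesis by (simp add: \<mu>_def)
qed

text \<open>The description in \<open>coroot\<close> is unique: if w \<alpha> i = v \<alpha> j, then
  \<open>winv v \<cdot> w\<close> carries one simple root to the other, hence one simple coroot to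
  the other.\<close>

lemma coroot_act_simple:
  assumes "w \<in> W" "i \<in> idx D"
  shows "coroot D (act_root w (\<alpha> i)) = act_coweight w (\<alpha>v i)"
  unfolding coroot_def
proof (rule the_equality)
  show "\<exists>v\<in>W. \<exists>j\<in>idx D. act_root w (\<alpha> i) = act_root v (\<alpha> j) \<and>
      act_coweight w (\<alpha>v i) = act_coweight v (\<alpha>v j)"
    using assms by blast
  fix \<mu> assume "\<exists>v\<in>W. \<exists>j\<in>idx D. act_root w (\<alpha> i) = act_root v (\<alpha> j) \<and> \<mu> = act_coweight v (\<alpha>v j)"
  then obtain v j where v: "v \<in> W" "j \<in> idx D" "act_root w (\<alpha> i) = act_root v (\<alpha> j)"
    "\<mu> = act_coweight v (\<alpha>v j)"
    by blast
  then have "act_root (winv v \<cdot> w) (\<alpha> i) = \<alpha> j" using assms by (simp add: act_winv)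
  then have "act_coweight (winv v \<cdot> w) (\<alpha>v i) = \<alpha>v j"
    using assms v by (intro simple_coroot_conj wmult_in_W winv_in_W)
  then have "act_coweight v (act_coweight (winv v \<cdot> w) (\<alpha>v i)) = \<mu>" using v by simp
  then show "\<mu> = act_coweight w (\<alpha>v i)" using v(1) by (simp add: act_winv)
qed

lemma coroot_act:
  assumes "\<beta> \<in> Roots" "w \<in> W"
  shows "coroot D (act_root w \<beta>) = act_coweight w (coroot D \<beta>)"
proof -
  obtain v i where v: "v \<in> W" "i \<in> idx D" "\<beta> = act_root v (\<alpha> i)" using Roots_cases[OF assms(1)] .
  then show ?thesis
    using coroot_act_simple[of "w \<cdot> v" i] assms by (simp add: coroot_act_simple wmult_in_W)
qed

lemma pairing_coroot_self:
  assumes "\<beta> \<in> Roots"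
  shows "\<langle>coroot D \<beta>,\<beta>\<rangle> = 2"
proof -
  obtain v i where v: "v \<in> W" "i \<in> idx D" "\<beta> = act_root v (\<alpha> i)" using Roots_cases[OF assms(1)] .
  then show ?thesis by (simp add: coroot_act_simple pairing_invariant)
qed

lemma act_reflection:
  "act_root (reflection D \<beta>) q = q - frag_cmul \<langle>coroot D \<beta>,q\<rangle> \<beta>"
  "act_coweight (reflection D \<beta>) \<nu> = \<nu> - zscale \<langle>\<nu>,\<beta>\<rangle> (coroot D \<beta>)"
  by (simp_all add: reflection_def act_refl)

lemma reflection_conj:
  assumes "\<beta> \<in> Roots" "w \<in> W"
  shows "w \<cdot> reflection D \<beta> = reflection D (act_root w \<beta>) \<cdot> w"
  using refl_conj[OF assms(2)] by (simp add: reflection_def coroot_act assms)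

lemma reflection_in_W:
  assumes "\<beta> \<in> Roots"
  shows "reflection D \<beta> \<in> W"
proof -
  obtain v i where v: "v \<in> W" "i \<in> idx D" "\<beta> = act_root v (\<alpha> i)" using Roots_cases[OF assms(1)] .
  then have "reflection D \<beta> \<cdot> v = v \<cdot> s i"
    using refl_conj[OF v(1)] by (simp add: reflection_def coroot_act_simple)
  then have "reflection D \<beta> = v \<cdot> s i \<cdot> winv v" using v by (metis winv_cancel(3))
  then show ?thesis using v by (simp add: wmult_in_W s_in_W winv_in_W)
qed

lemma reflection_reflection:
  assumes "\<beta> \<in> Roots"
  shows "reflection D \<beta> \<cdot> reflection D \<beta> = e"
  unfolding reflection_def by (intro refl_involution pairing_coroot_self assms)

lemma winv_reflection: "\<beta> \<in> Roots \<Longrightarrow> winv (reflection D \<beta>) = reflection D \<beta>"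
  by (intro winv_eq reflection_reflection)

lemma wmult_reflection_cancel:
  assumes "\<beta> \<in> Roots"
  shows "w \<cdot> reflection D \<beta> \<cdot> reflection D \<beta> = w"
    and "reflection D \<beta> \<cdot> (reflection D \<beta> \<cdot> w) = w"
  using reflection_reflection[OF assms] by (metis wmult_assoc wmult_e)+

lemma act_reflection_self:
  assumes "\<beta> \<in> Roots"
  shows "act_root (reflection D \<beta>) \<beta> = - \<beta>"
  by (simp add: act_reflection pairing_coroot_self assms frag_cmul_eq_zscale zscale_2)

lemma coroot_minus:
  assumes "\<beta> \<in> Roots"
  shows "coroot D (- \<beta>) = - coroot D \<beta>"
proof -
  have "coroot D (- \<beta>) = act_coweight (reflection D \<beta>) (coroot D \<beta>)"
    using coroot_act[OF assms reflection_in_W[OF assms]] by (simp add: act_reflection_self assms)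
  also have "\<dots> = - coroot D \<beta>"
    by (simp add: act_reflection pairing_coroot_self assms zscale_2)
  finally show ?thesis .
qed

lemma reflection_minus:
  assumes "\<beta> \<in> Roots"
  shows "reflection D (- \<beta>) = reflection D \<beta>"
proof (rule weyl_eqI)
  show "act_root (reflection D (- \<beta>)) q = act_root (reflection D \<beta>) q" for q
    by (rule poly_mapping_eqI)
      (simp add: act_reflection coroot_minus assms pairing_simps lookup_minus)
  show "act_coweight (reflection D (- \<beta>)) \<mu> = act_coweight (reflection D \<beta>) \<mu>" for \<mu>
    by (simp add: act_reflection coroot_minus assms pairing_simps)
qed

section \<open>Inversion counts under multiplication by a reflection\<close>

text \<open>
  The map sending \<open>\<gamma>\<close> to \<open>s\<^sub>\<delta> \<gamma>\<close> if that is positive, and to \<open>\<gamma>\<close> otherwise, is an injection from the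
  inversions of \<open>u\<close> to those of \<open>u s\<^sub>\<delta>\<close>, and it misses \<open>\<delta>\<close>.
\<close>

lemma len_less_wmult_reflection:
  assumes "u \<in> W" "\<delta> \<in> Pos" "act_root u \<delta> \<in> Pos"
  shows "len u < len (u \<cdot> reflection D \<delta>)"
proof -
  have \<delta>: "\<delta> \<in> Roots" using assms by (simp add: Pos_in_Roots)
  define r where "r = reflection D \<delta>"
  have r: "r \<in> W" "u \<cdot> r \<in> W" using assms \<delta> by (simp_all add: r_def reflection_in_W wmult_in_W)
  have rr: "act_root r (act_root r \<gamma>) = \<gamma>" for \<gamma>
    using reflection_reflection[OF \<delta>] by (metis r_def act_wmult(1) act_e(1))
  define f where "f \<gamma> = (if act_root r \<gamma> \<in> Pos then act_root r \<gamma> else \<gamma>)" for \<gamma>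
  have "inj_on f (Inv u)"
  proof (rule inj_onI)
    fix \<gamma> \<gamma>' assume "\<gamma> \<in> Inv u" "\<gamma>' \<in> Inv u" "f \<gamma> = f \<gamma>'"
    moreover from this have "\<gamma> \<in> Pos" "\<gamma>' \<in> Pos" using assms by (auto simp: Inv_iff)
    \<comment> \<open>In the mixed case r \<gamma> = \<gamma>', so r \<gamma>' = \<gamma> would be
      positive, although the second root is one that \<open>f\<close> leaves alone.\<close>
    ultimately show "\<gamma> = \<gamma>'" unfolding f_def by (metis rr)
  qed
  have "\<delta> \<in> Inv (u \<cdot> r)"
    using assms r by (simp add: Inv_iff r_def act_reflection_self \<delta> act_simps)
  moreover have "f \<gamma> \<in> Inv (u \<cdot> r)" "f \<gamma> \<noteq> \<delta>" if "\<gamma> \<in> Inv u" for \<gamma>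
  proof -
    have \<gamma>: "\<gamma> \<in> Pos" "- act_root u \<gamma> \<in> Pos" using that assms by (simp_all add: Inv_iff)
    show "f \<gamma> \<noteq> \<delta>"
    proof
      assume *: "f \<gamma> = \<delta>"
      show False
      proof (cases "act_root r \<gamma> \<in> Pos")
        case True
        then have "\<gamma> = - \<delta>" using * rr[of \<gamma>] \<delta> by (simp add: f_def r_def act_reflection_self)
        then show False using \<gamma> assms not_Pos_and_Neg by simp
      next
        case False
        then show False using * \<gamma> assms not_Pos_and_Neg by (auto simp: f_def)
      qed
    qed
    show "f \<gamma> \<in> Inv (u \<cdot> r)"
    proof (cases "act_root r \<gamma> \<in> Pos")
      case True
      then show ?thesis using \<gamma> r by (simp add: f_def Inv_iff rr)
    next
      case False
      define c where "c = \<langle>coroot D \<delta>,\<gamma>\<rangle>"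
      have rg: "act_root r \<gamma> = \<gamma> - frag_cmul c \<delta>" by (simp add: c_def r_def act_reflection)
      \<comment> \<open>Since r \<gamma> = \<gamma> - c \<delta> is not positive, c must be; then -
        u (r \<gamma>) = - u \<gamma> + c (u \<delta>) is a nonnegative combination of positive
        roots.\<close>
      have "c > 0"
      proof (rule ccontr)
        assume "\<not> c > 0"
        then have "nonneg (frag_cmul 1 \<gamma> + frag_cmul (- c) \<delta>)"
          using \<gamma> assms by (intro nonneg_cmul_add) (auto simp: Pos_iff)
        then have "nonneg (act_root r \<gamma>)" by (simp add: rg nonneg_diff_cmul)
        then show False using False \<gamma> r by (simp add: Pos_iff act_in_Roots)
      qed
      then have "nonneg (frag_cmul 1 (- act_root u \<gamma>) + frag_cmul c (act_root u \<delta>))"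
        using \<gamma> assms by (intro nonneg_cmul_add) (auto simp: Pos_iff)
      then have "nonneg (- act_root (u \<cdot> r) \<gamma>)" using assms by (simp add: rg act_simps)
      then have "- act_root (u \<cdot> r) \<gamma> \<in> Pos"
        using \<gamma> r assms(1) by (simp add: Pos_iff minus_in_Roots act_in_Roots)
      then show ?thesis using False \<gamma> r by (simp add: f_def Inv_iff)
    qed
  qed
  ultimately have "f ` Inv u \<subseteq> Inv (u \<cdot> r)" "\<delta> \<in> Inv (u \<cdot> r) - f ` Inv u" by auto
  then have "f ` Inv u \<subset> Inv (u \<cdot> r)" by blast
  then have "card (f ` Inv u) < card (Inv (u \<cdot> r))"
    by (intro psubset_card_mono finite_Inv r)
  then show ?thesis using \<open>inj_on f (Inv u)\<close> by (simp add: len_def card_image r_def)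
qed

lemma len_reflection_wmult:
  assumes "v \<in> W" "\<delta> \<in> Pos"
  shows len_less_reflection_wmult:
      "act_root (winv v) \<delta> \<in> Pos \<Longrightarrow> len v < len (reflection D \<delta> \<cdot> v)"
    and len_reflection_wmult_less:
      "- act_root (winv v) \<delta> \<in> Pos \<Longrightarrow> len (reflection D \<delta> \<cdot> v) < len v"
proof -
  have \<delta>: "\<delta> \<in> Roots" using assms by (simp add: Pos_in_Roots)
  note r = reflection_in_W[OF \<delta>]
  have len_eq: "len (reflection D \<delta> \<cdot> v) = len (winv v \<cdot> reflection D \<delta>)"
    using len_winv[OF wmult_in_W[OF r assms(1)]] winv_wmult_distrib[OF r assms(1)]
    by (simp add: winv_reflection \<delta>)
  show "len v < len (reflection D \<delta> \<cdot> v)" if "act_root (winv v) \<delta> \<in> Pos"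
    using len_less_wmult_reflection[OF winv_in_W[OF assms(1)] assms(2) that] len_eq assms by simp
  show "len (reflection D \<delta> \<cdot> v) < len v" if "- act_root (winv v) \<delta> \<in> Pos"
    using len_less_wmult_reflection[of "winv v \<cdot> reflection D \<delta>" \<delta>] that len_eq assms r \<delta>
    by (simp add: wmult_in_W winv_in_W act_reflection_self act_simps wmult_reflection_cancel)
qed

section \<open>Dominant coweights\<close>

lemma dominant_Pos:
  assumes "dominant D l" "\<gamma> \<in> Pos"
  shows "0 \<le> \<langle>l,\<gamma>\<rangle>"
  unfolding pairing_def
proof (rule sum_nonneg)
  fix i assume "i \<in> idx D"
  then show "0 \<le> Poly_Mapping.lookup \<gamma> i * simple_functional D i l"
    using assms by (intro mult_nonneg_nonneg) (auto simp: dominant_def Pos_iff nonneg_def pairing_simple)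
qed

text \<open>Take v with the fewest inversions in its coset. If an inversion \<gamma> of
  \<open>winv v\<close> had \<langle>v l,\<gamma>\<rangle> \<ge> 0, dominance would force the value
  0, so the reflection in \<gamma> would fix v l and shorten v.\<close>

lemma minimal_representative:
  assumes "v0 \<in> W" "dominant D l"
  obtains v where "v \<in> W" "act_coweight v l = act_coweight v0 l"
    "\<And>\<gamma>. \<gamma> \<in> Inv (winv v) \<Longrightarrow> \<langle>act_coweight v l,\<gamma>\<rangle> < 0"
proof -
  define P where "P v \<longleftrightarrow> v \<in> W \<and> act_coweight v l = act_coweight v0 l" for v
  define v where "v = arg_min len P"
  have "P v0" using assms by (simp add: P_def)
  then have "P v" unfolding v_def by (rule arg_min_natI)
  then have v: "v \<in> W" "act_coweight v l = act_coweight v0 l" by (simp_all add: P_def)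
  have "\<langle>act_coweight v l,\<gamma>\<rangle> < 0" if \<gamma>: "\<gamma> \<in> Inv (winv v)" for \<gamma>
  proof (rule ccontr)
    assume *: "\<not> \<langle>act_coweight v l,\<gamma>\<rangle> < 0"
    have \<gamma>': "\<gamma> \<in> Pos" "- act_root (winv v) \<gamma> \<in> Pos" using \<gamma> v by (simp_all add: Inv_iff winv_in_W)
    have "0 \<le> \<langle>l,- act_root (winv v) \<gamma>\<rangle>" using dominant_Pos[OF assms(2) \<gamma>'(2)] .
    then have "\<langle>act_coweight v l,\<gamma>\<rangle> = 0" using *
      unfolding pairing_act_left[OF v(1)] additive.minus[OF additive_pairing_right] by linarith
    then have "act_coweight (reflection D \<gamma> \<cdot> v) l = act_coweight v l" by (simp add: act_reflection)
    then have "P (reflection D \<gamma> \<cdot> v)"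
      using v \<gamma>' by (simp add: P_def wmult_in_W reflection_in_W Pos_in_Roots)
    then have "len v \<le> len (reflection D \<gamma> \<cdot> v)" unfolding v_def by (rule arg_min_nat_le)
    then show False using len_reflection_wmult_less[OF v(1) \<gamma>'] by simp
  qed
  then show ?thesis using that v by blast
qed

text \<open>An inversion of the inverse of the minimal representative would pair negatively with the
  dominant coweight w l, so this representative is trivial.\<close>

lemma dominant_unique:
  assumes "w \<in> W" "dominant D l" "dominant D (act_coweight w l)"
  shows "act_coweight w l = l"
proof -
  obtain v where v: "v \<in> W" "act_coweight v l = act_coweight w l"
    "\<And>\<gamma>. \<gamma> \<in> Inv (winv v) \<Longrightarrow> \<langle>act_coweight v l,\<gamma>\<rangle> < 0"
    using minimal_representative[OF assms(1,2)] by blast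
  have "Inv (winv v) = {}"
  proof (intro equals0I)
    fix \<gamma> assume "\<gamma> \<in> Inv (winv v)"
    then have "\<langle>act_coweight w l,\<gamma>\<rangle> < 0" "\<gamma> \<in> Pos"
      using v by (auto simp: Inv_iff winv_in_W)
    then show False using dominant_Pos[OF assms(3)] by fastforce
  qed
  then have "winv v = e" using v by (intro eq_e_if_Inv_empty winv_in_W)
  then have "v = e" using winv_winv[OF v(1)] by simp
  then show ?thesis using v by simp
qed

lemma dominant_rep_eq:
  assumes "v \<in> W" "dominant D l"
  shows "dominant_rep D (act_coweight v l) = l"
  unfolding dominant_rep_def
proof (rule the_equality)
  show "dominant D l \<and> (\<exists>w\<in>W. l = act_coweight w (act_coweight v l))"
    using assms by (auto simp: act_winv intro!: bexI[of _ "winv v"] winv_in_W)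
  fix \<nu> assume "dominant D \<nu> \<and> (\<exists>w\<in>W. \<nu> = act_coweight w (act_coweight v l))"
  then obtain w where w: "w \<in> W" "dominant D \<nu>" "\<nu> = act_coweight (w \<cdot> v) l" by auto
  then show "\<nu> = l" using dominant_unique[of "w \<cdot> v" l] assms by (simp add: wmult_in_W)
qed

lemma tits_cone_representative:
  assumes "\<mu> \<in> tits_cone D"
  obtains v l where "v \<in> W" "dominant D l" "\<mu> = act_coweight v l"
    "\<And>\<gamma>. \<gamma> \<in> Inv (winv v) \<Longrightarrow> \<langle>\<mu>,\<gamma>\<rangle> < 0"
proof -
  obtain w where w: "w \<in> W" "dominant D (act_coweight w \<mu>)"
    using assms by (auto simp: tits_cone_def)
  obtain v where "v \<in> W" "act_coweight v (act_coweight w \<mu>) = act_coweight (winv w) (act_coweight w \<mu>)"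
    "\<And>\<gamma>. \<gamma> \<in> Inv (winv v) \<Longrightarrow> \<langle>act_coweight v (act_coweight w \<mu>),\<gamma>\<rangle> < 0"
    using minimal_representative[OF winv_in_W[OF w(1)] w(2)] by blast
  then show ?thesis using that w by (simp add: act_winv)
qed

lemma act_in_tits_cone:
  assumes "w \<in> W" "\<mu> \<in> tits_cone D"
  shows "act_coweight w \<mu> \<in> tits_cone D"
proof -
  obtain v where v: "v \<in> W" "dominant D (act_coweight v \<mu>)"
    using assms by (auto simp: tits_cone_def)
  then have "dominant D (act_coweight (v \<cdot> winv w) (act_coweight w \<mu>))"
    using assms by (simp add: act_winv)
  moreover have "v \<cdot> winv w \<in> W" using v assms by (simp add: wmult_in_W winv_in_W)
  ultimately show ?thesis unfolding tits_cone_def by blast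
qed

section \<open>Heights and the length function\<close>

context
  fixes \<rho> :: "'p \<Rightarrow> real"
  assumes rho: "is_rho D \<rho>"
begin

section \<open>The values of \<rho> on orbits and coroots\<close>

lemma additive_rho: "additive \<rho>"
proof -
  obtain \<Lambda> where \<Lambda>: "fundamental_weights D \<Lambda>" "\<rho> = (\<lambda>\<mu>. \<Sum>i\<in>idx D. \<Lambda> i \<mu>)"
    using rho by (auto simp: is_rho_def)
  then have "\<Lambda> i (x + y) = \<Lambda> i x + \<Lambda> i y" if "i \<in> idx D" for i x y
    using that by (auto simp: fundamental_weights_def dest: additive.add)
  then show ?thesis unfolding \<Lambda>(2) by unfold_locales (simp add: sum.distrib)
qed

lemma rho_simple_coroot: "i \<in> idx D \<Longrightarrow> \<rho> (\<alpha>v i) = 1"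
  using rho finite_idx by (auto simp: is_rho_def fundamental_weights_def)

text \<open>This is the classical identity that \<rho> minus its translate by \<open>winv w\<close>
  is the sum of the inversions of w, evaluated at \<mu>. With \<eta> = \<open>winv w\<close>
  \<alpha> i, multiplying by \<open>s i\<close> either adds the inversion \<eta> or removes -
  \<eta>; both change the sum by \<langle>\<mu>,\<eta>\<rangle>.\<close>

lemma rho_act:
  assumes "w \<in> W"
  shows "\<rho> (act_coweight w \<mu>) = \<rho> \<mu> - of_int (\<Sum>\<gamma>\<in>Inv w. \<langle>\<mu>,\<gamma>\<rangle>)"
  using assms
proof induction
  case one
  show ?case unfolding e_def[symmetric] by simp
next
  case (simple i w)
  define \<eta> where "\<eta> = act_root (winv w) (\<alpha> i)"
  have w\<eta>: "act_root w \<gamma> = \<alpha> i \<longleftrightarrow> \<gamma> = \<eta>" "act_root w \<gamma> = - \<alpha> i \<longleftrightarrow> \<gamma> = - \<eta>" for \<gamma>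
    using simple.hyps inj_act_root[of w] unfolding \<eta>_def
    by (metis act_winv(1,2), metis act_winv(1,2) additive.minus[OF additive_act(1)])
  have \<eta>: "\<eta> \<in> Roots" using simple.hyps by (simp add: \<eta>_def act_in_Roots simple_in_Roots winv_in_W)
  have Inv: "\<gamma> \<in> Inv (s i \<cdot> w) \<longleftrightarrow> \<gamma> \<in> Pos \<and> \<gamma> \<noteq> - \<eta> \<and> (\<gamma> \<in> Inv w \<or> \<gamma> = \<eta>)" for \<gamma>
    using simple.hyps s_Pos_iff[of "act_root w \<gamma>" i] w\<eta>
    by (auto simp: Inv_iff_not_Pos wmult_in_W s_in_W act_in_Roots Pos_in_Roots)
  have w_\<eta>: "act_root w \<eta> = \<alpha> i" using w\<eta>(1) by blast
  have \<eta>_Inv: "\<eta> \<notin> Inv w"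
    using simple.hyps w_\<eta> by (simp add: Inv_iff_not_Pos simple_in_Pos)
  have minus_\<eta>_Inv: "- \<eta> \<in> Inv w" if "- \<eta> \<in> Pos"
    using simple.hyps w_\<eta> that by (simp add: Inv_iff simple_in_Pos act_simps)
  have Inv_Pos: "\<gamma> \<in> Inv w \<Longrightarrow> \<gamma> \<in> Pos" for \<gamma> using simple.hyps by (simp add: Inv_iff)
  have fin: "finite (Inv w)" using simple.hyps by (simp add: finite_Inv)
  have sum: "(\<Sum>\<gamma>\<in>Inv (s i \<cdot> w). \<langle>\<mu>,\<gamma>\<rangle>) = (\<Sum>\<gamma>\<in>Inv w. \<langle>\<mu>,\<gamma>\<rangle>) + \<langle>\<mu>,\<eta>\<rangle>"
  proof (cases "\<eta> \<in> Pos")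
    case True
    then have "- \<eta> \<notin> Pos" using not_Pos_and_Neg by blast
    then have "\<gamma> \<in> Inv (s i \<cdot> w) \<longleftrightarrow> \<gamma> \<in> insert \<eta> (Inv w)" for \<gamma>
      using Inv[of \<gamma>] True Inv_Pos[of \<gamma>] by auto
    then have "Inv (s i \<cdot> w) = insert \<eta> (Inv w)" by (rule set_eqI)
    then show ?thesis using \<eta>_Inv fin by simp
  next
    case False
    then have "- \<eta> \<in> Pos" using \<eta> Roots_Pos_or_Neg by blast
    have "\<gamma> \<in> Inv (s i \<cdot> w) \<longleftrightarrow> \<gamma> \<in> Inv w - {- \<eta>}" for \<gamma>
      using Inv[of \<gamma>] False Inv_Pos[of \<gamma>] by auto
    then have "Inv (s i \<cdot> w) = Inv w - {- \<eta>}" by (rule set_eqI)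
    then show ?thesis using minus_\<eta>_Inv[OF \<open>- \<eta> \<in> Pos\<close>] fin by (simp add: sum_diff1 pairing_simps)
  qed
  have "\<rho> (act_coweight (s i \<cdot> w) \<mu>) =
      \<rho> (act_coweight w \<mu>) - of_int \<langle>act_coweight w \<mu>,\<alpha> i\<rangle>"
    using simple.hyps
    by (simp add: act_refl additive.diff[OF additive_rho] additive_zscale[OF additive_rho] rho_simple_coroot)
  also have "\<langle>act_coweight w \<mu>,\<alpha> i\<rangle> = \<langle>\<mu>,\<eta>\<rangle>" using simple.hyps by (simp add: \<eta>_def pairing_act_left)
  finally show ?case using simple.IH sum by simp
qed

text \<open>The reflection negates the coroot of \<delta>, so \<open>rho_act\<close> writes twice
  its \<rho>-value as a sum over the inversions of the reflection: \<delta> contributes 2 and every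
  other inversion at least 1.\<close>

lemma rho_coroot:
  assumes "\<delta> \<in> Pos"
  obtains S where "2 * \<rho> (coroot D \<delta>) = of_int S" "int (len (reflection D \<delta>)) + 1 \<le> S"
proof
  define r where "r = reflection D \<delta>"
  have \<delta>: "\<delta> \<in> Roots" using assms by (simp add: Pos_in_Roots)
  then have r: "r \<in> W" by (simp add: r_def reflection_in_W)
  show "2 * \<rho> (coroot D \<delta>) = of_int (\<Sum>\<gamma>\<in>Inv r. \<langle>coroot D \<delta>,\<gamma>\<rangle>)"
    using rho_act[OF r, of "coroot D \<delta>"] \<delta>
    by (simp add: r_def act_reflection pairing_coroot_self zscale_2 additive.minus[OF additive_rho])
  have \<delta>r: "\<delta> \<in> Inv r" using assms \<delta> r by (simp add: Inv_iff r_def act_reflection_self)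
  have "1 \<le> \<langle>coroot D \<delta>,\<gamma>\<rangle>" if "\<gamma> \<in> Inv r" for \<gamma>
  proof (rule ccontr)
    assume *: "\<not> 1 \<le> \<langle>coroot D \<delta>,\<gamma>\<rangle>"
    have \<gamma>: "\<gamma> \<in> Pos" "- act_root r \<gamma> \<in> Pos" using that r by (simp_all add: Inv_iff)
    have "nonneg (frag_cmul 1 \<gamma> + frag_cmul (- \<langle>coroot D \<delta>,\<gamma>\<rangle>) \<delta>)"
      using * \<gamma> assms by (intro nonneg_cmul_add) (auto simp: Pos_iff)
    then have "nonneg (act_root r \<gamma>)"
      by (simp add: r_def act_reflection nonneg_diff_cmul)
    then have "act_root r \<gamma> \<in> Pos" using \<gamma> r by (simp add: Pos_iff act_in_Roots)
    then show False using \<gamma> not_Pos_and_Neg by blast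
  qed
  then have "(\<Sum>\<gamma>\<in>Inv r - {\<delta>}. 1) \<le> (\<Sum>\<gamma>\<in>Inv r - {\<delta>}. \<langle>coroot D \<delta>,\<gamma>\<rangle>)"
    by (intro sum_mono) auto
  then have "int (len r - 1) + 2 \<le> (\<Sum>\<gamma>\<in>Inv r. \<langle>coroot D \<delta>,\<gamma>\<rangle>)"
    using \<delta>r \<delta> r by (simp add: sum.remove[of "Inv r" \<delta>] finite_Inv pairing_coroot_self len_def)
  then show "int (len (reflection D \<delta>)) + 1 \<le> (\<Sum>\<gamma>\<in>Inv r. \<langle>coroot D \<delta>,\<gamma>\<rangle>)"
    by (simp add: r_def)
qed

lemma two_ht_gap:
  assumes "z \<in> W" "\<delta> \<in> Pos" "k > 0" "\<nu> = l + zscale k (coroot D \<delta>)"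
    and neg: "\<And>\<gamma>. \<gamma> \<in> Inv (winv z) \<Longrightarrow> \<langle>\<nu>,\<gamma>\<rangle> < 0"
  shows "two_ht \<rho> l + int (len z) + int (len (reflection D \<delta> \<cdot> z)) < two_ht \<rho> (act_coweight (winv z) \<nu>)"
proof -
  obtain S where S: "2 * \<rho> (coroot D \<delta>) = of_int S" "int (len (reflection D \<delta>)) + 1 \<le> S"
    using rho_coroot[OF assms(2)] .
  define T where "T = (\<Sum>\<gamma>\<in>Inv (winv z). \<langle>\<nu>,\<gamma>\<rangle>)"
  have "T \<le> (\<Sum>\<gamma>\<in>Inv (winv z). - 1)"
    unfolding T_def by (rule sum_mono) (use neg in fastforce)
  also have "\<dots> = - int (len z)" using len_winv[OF assms(1)] by (simp add: len_def)
  finally have T: "T \<le> - int (len z)" .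
  have "2 * \<rho> (act_coweight (winv z) \<nu>) = 2 * \<rho> l + of_int k * (2 * \<rho> (coroot D \<delta>)) - 2 * of_int T"
    unfolding rho_act[OF winv_in_W[OF assms(1)]] T_def assms(4)
    by (simp add: additive.add[OF additive_rho] additive_zscale[OF additive_rho])
  \<comment> \<open>The value 2 \<rho> l need not be an integer, but the correction is, so it passes
    through the floor.\<close>
  also have "\<dots> = 2 * \<rho> l + of_int (k * S - 2 * T)" unfolding S(1) by simp
  finally have "two_ht \<rho> (act_coweight (winv z) \<nu>) = two_ht \<rho> l + (k * S - 2 * T)"
    by (simp only: two_ht_def floor_add_int[symmetric])
  moreover have "1 * S \<le> k * S" using assms(3) S(2) by (intro mult_right_mono) auto
  moreover have "len (reflection D \<delta> \<cdot> z) \<le> len (reflection D \<delta>) + len z"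
    using assms by (intro len_wmult_le reflection_in_W Pos_in_Roots)
  \<comment> \<open>The gain k S - 2 T is at least
    \<open>len (reflection D \<delta>) + 1 + 2 * len z\<close>, and subadditivity bounds
    \<open>len (reflection D \<delta> \<cdot> z)\<close> by
    \<open>len (reflection D \<delta>) + len z\<close>.\<close>
  ultimately show ?thesis using T S(2) by linarith
qed

section \<open>Lengths from factorisations\<close>

text \<open>The length counts |A| - 2 |N|, while \<open>len (winv v \<cdot> w) - len v\<close>
  equals |A| - 2 |A \<inter> B|. Dominance of l puts N inside A \<inter> B; if all of B pairs
  negatively with \<mu>, the two sets agree.\<close>

lemma
  assumes v: "v \<in> W" and w: "w \<in> W" and l: "dominant D l" and \<mu>: "\<mu> = act_coweight v l"
  shows aff_length_ge:
      "two_ht \<rho> l + int (len (winv v \<cdot> w)) - int (len v) \<le> aff_length D \<rho> (\<mu>, w)"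
    and aff_length_eq: "(\<And>\<gamma>. \<gamma> \<in> Inv (winv v) \<Longrightarrow> \<langle>\<mu>,\<gamma>\<rangle> < 0) \<Longrightarrow>
      aff_length D \<rho> (\<mu>, w) = two_ht \<rho> l + int (len (winv v \<cdot> w)) - int (len v)"
proof -
  define A B where "A = Inv (winv w)" and "B = Inv (winv v)"
  define N where "N = {\<gamma> \<in> A. \<langle>\<mu>,\<gamma>\<rangle> < 0}"
  have fin: "finite A" "finite B" using v w by (simp_all add: A_def B_def finite_Inv winv_in_W)
  have "{\<gamma> \<in> A. 0 \<le> \<langle>\<mu>,\<gamma>\<rangle>} = A - N" by (auto simp: N_def)
  then have "card {\<gamma> \<in> A. 0 \<le> \<langle>\<mu>,\<gamma>\<rangle>} = card A - card N"
    using fin by (simp add: card_Diff_subset N_def)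
  moreover have "card N \<le> card A" using fin by (intro card_mono) (auto simp: N_def)
  ultimately have aff: "aff_length D \<rho> (\<mu>, w) = two_ht \<rho> l + int (card A) - 2 * int (card N)"
    unfolding \<mu> by (simp add: dominant_rep_eq v l A_def N_def \<mu>)
  have "len v = card B" using len_winv[OF v] by (simp add: len_def B_def)
  moreover have "len (winv v \<cdot> w) = card (A - B) + card (B - A)"
    using len_winv_wmult[OF v w] by (simp add: A_def B_def)
  moreover have "card A = card (A \<inter> B) + card (A - B)" "card B = card (B \<inter> A) + card (B - A)"
    using fin by (metis card_Int_Diff)+
  ultimately have len: "int (len (winv v \<cdot> w)) - int (len v) = int (card A) - 2 * int (card (A \<inter> B))"
    by (simp add: Int_commute)
  have N: "N \<subseteq> A \<inter> B"
  proof
    fix \<gamma> assume "\<gamma> \<in> N"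
    then have \<gamma>: "\<gamma> \<in> A" "\<gamma> \<in> Pos" "\<langle>l,act_root (winv v) \<gamma>\<rangle> < 0"
      using v w by (simp_all add: N_def A_def \<mu> pairing_act_left Inv_iff winv_in_W)
    then have "act_root (winv v) \<gamma> \<notin> Pos" using dominant_Pos[OF l] by fastforce
    then show "\<gamma> \<in> A \<inter> B" using \<gamma> v by (simp add: B_def Inv_iff_not_Pos winv_in_W)
  qed
  then have "card N \<le> card (A \<inter> B)" using fin by (intro card_mono) auto
  then show "two_ht \<rho> l + int (len (winv v \<cdot> w)) - int (len v) \<le> aff_length D \<rho> (\<mu>, w)"
    using aff len by simp
  assume "\<And>\<gamma>. \<gamma> \<in> Inv (winv v) \<Longrightarrow> \<langle>\<mu>,\<gamma>\<rangle> < 0"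
  then have "N = A \<inter> B" using N by (auto simp: N_def B_def)
  then show "aff_length D \<rho> (\<mu>, w) = two_ht \<rho> l + int (len (winv v \<cdot> w)) - int (len v)"
    using aff len by simp
qed

text \<open>With \<nu> = z l', the two new coweights are (v z) l' and (v r z) l'. The right-hand
  factor u turns into \<open>winv z \<cdot> (r \<cdot> u)\<close> or
  \<open>winv z \<cdot> u\<close>, so z and r z exchange roles and both cases lose at most
  \<open>len z + len (r \<cdot> z)\<close>, which \<open>two_ht_gap\<close> outweighs.\<close>

lemma
  assumes v: "v \<in> W" and u: "u \<in> W" and \<delta>: "\<delta> \<in> Pos" and k: "k > 0"
    and \<nu>: "\<nu> = l + zscale k (coroot D \<delta>)" and cone: "\<nu> \<in> tits_cone D"
  defines "r \<equiv> reflection D \<delta>"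
  shows aff_length_translate: "two_ht \<rho> l + int (len u) - int (len v) <
      aff_length D \<rho> (act_coweight v \<nu>, v \<cdot> r \<cdot> u)"
    and aff_length_translate_reflect: "two_ht \<rho> l + int (len u) - int (len v) <
      aff_length D \<rho> (act_coweight (v \<cdot> r) \<nu>, v \<cdot> r \<cdot> u)"
proof -
  obtain z l' where z: "z \<in> W" "dominant D l'" "\<nu> = act_coweight z l'"
    "\<And>\<gamma>. \<gamma> \<in> Inv (winv z) \<Longrightarrow> \<langle>\<nu>,\<gamma>\<rangle> < 0"
    using tits_cone_representative[OF cone] by blast
  have r: "r \<in> W" using \<delta> by (simp add: r_def reflection_in_W Pos_in_Roots)
  note W = v u r z(1) wmult_in_W winv_in_W
  have rr: "r \<cdot> (r \<cdot> w) = w" for w using \<delta> by (simp add: r_def wmult_reflection_cancel Pos_in_Roots)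
  have "act_coweight (winv z) \<nu> = l'" using z by (simp add: act_winv)
  then have gap: "two_ht \<rho> l + int (len z) + int (len (r \<cdot> z)) < two_ht \<rho> l'"
    using two_ht_gap[OF z(1) \<delta> k \<nu> z(4)] by (simp add: r_def)
  have "len u \<le> len (r \<cdot> z) + len (winv z \<cdot> (r \<cdot> u))"
    using len_wmult_le[of "r \<cdot> z" "winv z \<cdot> (r \<cdot> u)"] W rr by (simp add: wmult_assoc[symmetric] winv_cancel)
  moreover have "len (v \<cdot> z) \<le> len v + len z" by (intro len_wmult_le W)
  moreover have "winv (v \<cdot> z) \<cdot> (v \<cdot> r \<cdot> u) = winv z \<cdot> (r \<cdot> u)"
    using W by (simp add: winv_wmult_distrib wmult_assoc[symmetric] winv_cancel)
  ultimately show "two_ht \<rho> l + int (len u) - int (len v) <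
      aff_length D \<rho> (act_coweight v \<nu>, v \<cdot> r \<cdot> u)"
    using aff_length_ge[of "v \<cdot> z" "v \<cdot> r \<cdot> u" l' "act_coweight v \<nu>"] W z(2,3) gap by simp
  have "len u \<le> len z + len (winv z \<cdot> u)"
    using len_wmult_le[of z "winv z \<cdot> u"] W by (simp add: winv_cancel)
  moreover have "len (v \<cdot> (r \<cdot> z)) \<le> len v + len (r \<cdot> z)" by (intro len_wmult_le W)
  moreover have "winv (v \<cdot> (r \<cdot> z)) \<cdot> (v \<cdot> r \<cdot> u) = winv z \<cdot> u"
  proof -
    have "v \<cdot> r \<cdot> u = v \<cdot> (r \<cdot> z) \<cdot> (winv z \<cdot> u)" using W by (simp add: wmult_assoc winv_cancel)
    then show ?thesis using winv_cancel(1)[of "v \<cdot> (r \<cdot> z)"] W by simp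
  qed
  ultimately show "two_ht \<rho> l + int (len u) - int (len v) <
      aff_length D \<rho> (act_coweight (v \<cdot> r) \<nu>, v \<cdot> r \<cdot> u)"
    using aff_length_ge[of "v \<cdot> (r \<cdot> z)" "v \<cdot> r \<cdot> u" l' "act_coweight (v \<cdot> r) \<nu>"] W z(2,3) gap
    by simp
qed

text \<open>
  With \<open>\<gamma> = w \<beta>\<close> and \<open>m = n + \<langle>\<mu>, \<gamma>\<rangle>\<close>, a step multiplies \<open>\<pi>\<^sup>\<mu> w\<close> on the left by the reflection
  in \<open>\<gamma> + m \<pi>\<close>; it goes up only if \<open>m n \<ge> 0\<close>. For \<open>n = 0\<close> or \<open>m = 0\<close> the coweight stays in its
  orbit, otherwise it moves out along its \<open>\<gamma>\<^sup>\<or>\<close>-string.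
\<close>

lemma aff_length_step:
  assumes "bruhat_step D x y"
  shows "aff_length D \<rho> x < aff_length D \<rho> y"
proof -
  obtain \<mu> w where x: "x = (\<mu>, w)" by (cases x)
  have w: "w \<in> W" and \<mu>: "\<mu> \<in> tits_cone D" and yW: "y \<in> aff_weyl_semigroup D"
    using assms by (auto simp: bruhat_step_def aff_weyl_semigroup_def x)
  obtain \<beta> n where \<beta>: "\<beta> \<in> Pos" and y: "y = aff_mult x (aff_reflection D \<beta> n)"
    and pos: "aff_pos D (aff_act D x (aff_root_of \<beta> n))"
    using assms by (auto simp: bruhat_step_def)
  define \<gamma> where "\<gamma> = act_root w \<beta>"
  define m where "m = n + \<langle>\<mu>,\<gamma>\<rangle>"
  have \<beta>R: "\<beta> \<in> Roots" using \<beta> by (rule Pos_in_Roots)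
  have \<gamma>R: "\<gamma> \<in> Roots" using w \<beta>R by (simp add: \<gamma>_def act_in_Roots)
  define \<mu>' where "\<mu>' = \<mu> + zscale n (coroot D \<gamma>)"
  have y': "y = (\<mu>', reflection D \<gamma> \<cdot> w)"
    unfolding y x aff_mult_def aff_reflection_def \<mu>'_def \<gamma>_def
    using w \<beta>R by (simp add: reflection_conj coroot_act act_simps)
  have \<mu>'T: "\<mu>' \<in> tits_cone D" using yW by (simp add: y' aff_weyl_semigroup_def)
  \<comment> \<open>The image of \<beta>[n] is \<gamma> + m \<pi> for n \<ge> 0 and its negative for
    n < 0.\<close>
  have pos_nonneg: "\<gamma> \<in> Pos \<and> m \<ge> 0 \<or> - \<gamma> \<in> Pos \<and> m > 0" if "n \<ge> 0"
    using pos that by (simp add: x aff_root_of_def \<gamma>_def m_def Neg_iff)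
  have pos_neg: "- \<gamma> \<in> Pos \<and> m \<le> 0 \<or> \<gamma> \<in> Pos \<and> m < 0" if "n < 0"
    using pos that w by (auto simp: x aff_root_of_def \<gamma>_def m_def Neg_iff act_simps pairing_simps)
  obtain v l where v: "v \<in> W" and l: "dominant D l" and vl: "\<mu> = act_coweight v l"
    and min: "\<And>\<gamma>. \<gamma> \<in> Inv (winv v) \<Longrightarrow> \<langle>\<mu>,\<gamma>\<rangle> < 0"
    using tits_cone_representative[OF \<mu>] by blast
  define u where "u = winv v \<cdot> w"
  have u: "u \<in> W" and vu: "v \<cdot> u = w" using v w by (simp_all add: u_def wmult_in_W winv_in_W winv_cancel)
  have len_x: "aff_length D \<rho> x = two_ht \<rho> l + int (len u) - int (len v)"
    using aff_length_eq[OF v w l vl min] by (simp only: x u_def)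
  define \<delta> where "\<delta> = act_root (winv v) \<gamma>"
  have \<delta>R: "\<delta> \<in> Roots" using v \<gamma>R by (simp add: \<delta>_def act_in_Roots winv_in_W)
  have v\<delta>: "act_root v \<delta> = \<gamma>" using v by (simp add: \<delta>_def act_winv)
  have l\<delta>: "\<langle>l,\<delta>\<rangle> = m - n" using v by (simp add: \<delta>_def m_def vl pairing_act_left)
  have v_coroot: "act_coweight v (coroot D \<delta>) = coroot D \<gamma>" using coroot_act[OF \<delta>R v] v\<delta> by simp
  have r\<gamma>v: "reflection D \<gamma> \<cdot> v = v \<cdot> reflection D \<delta>" using reflection_conj[OF \<delta>R v] v\<delta> by simp
  then have y'': "reflection D \<gamma> \<cdot> w = v \<cdot> reflection D \<delta> \<cdot> u" using vu by (metis wmult_assoc)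
  define \<nu>1 where "\<nu>1 = l + zscale n (coroot D \<delta>)"
  define \<nu>2 where "\<nu>2 = l + zscale (- m) (coroot D \<delta>)"
  have \<nu>1: "act_coweight v \<nu>1 = \<mu>'"
    using v by (simp add: \<nu>1_def \<mu>'_def act_simps v_coroot vl)
  have "act_coweight (reflection D \<delta>) \<nu>2 = \<nu>1"
    by (simp add: \<nu>1_def \<nu>2_def act_reflection pairing_simps pairing_coroot_self \<delta>R l\<delta> zscale_algebra
        zscale_mult_2 algebra_simps)
  then have \<nu>2: "act_coweight (v \<cdot> reflection D \<delta>) \<nu>2 = \<mu>'" using \<nu>1 by simp
  have "\<nu>1 = act_coweight (winv v) \<mu>'" using \<nu>1 v by (metis act_winv(3))
  then have \<nu>1_cone: "\<nu>1 \<in> tits_cone D" using act_in_tits_cone[OF winv_in_W[OF v] \<mu>'T] by simp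
  have vr: "v \<cdot> reflection D \<delta> \<in> W" using v \<delta>R by (simp add: wmult_in_W reflection_in_W)
  have "\<nu>2 = act_coweight (winv (v \<cdot> reflection D \<delta>)) \<mu>'" using \<nu>2 vr by (metis act_winv(3))
  then have \<nu>2_cone: "\<nu>2 \<in> tits_cone D" using act_in_tits_cone[OF winv_in_W[OF vr] \<mu>'T] by simp
  have r\<gamma>: "reflection D \<gamma> \<in> W" using \<gamma>R by (rule reflection_in_W)
  consider "n = 0" | "n \<noteq> 0" "m = 0" | "m > 0" "n > 0" | "m < 0" "n < 0"
    using pos_nonneg pos_neg by linarith
  then show ?thesis
  proof cases
    case 1
    \<comment> \<open>A negative \<delta> gives m \<le> 0 by dominance, hence m = 0 and \<gamma> >
      0. Then \<gamma> is an inversion of \<open>winv v\<close> pairing to 0 with \<mu>, against the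
      minimality of v.\<close>
    have \<delta>: "\<delta> \<in> Pos"
    proof (rule ccontr)
      assume *: "\<delta> \<notin> Pos"
      then have "- \<delta> \<in> Pos" using Roots_Pos_or_Neg[OF \<delta>R] by blast
      then have "m \<le> 0" using dominant_Pos[OF l] l\<delta> 1 by (fastforce simp: pairing_simps)
      with pos_nonneg 1 have "\<gamma> \<in> Pos" "m = 0" by auto
      then have "\<gamma> \<in> Inv (winv v)" using * v by (simp add: Inv_iff_not_Pos winv_in_W \<delta>_def)
      then show False using min[of \<gamma>] \<open>m = 0\<close> 1 by (simp add: m_def)
    qed
    have "act_root (winv u) \<delta> = \<beta>"
      using v w by (simp add: u_def winv_wmult_distrib winv_in_W winv_winv v\<delta>)
        (simp add: \<gamma>_def act_winv)
    then have "len u < len (reflection D \<delta> \<cdot> u)" using u \<delta> \<beta> by (intro len_less_reflection_wmult) auto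
    moreover have "winv v \<cdot> (reflection D \<gamma> \<cdot> w) = reflection D \<delta> \<cdot> u"
      unfolding y'' using v by (simp add: wmult_assoc[symmetric] winv_cancel)
    ultimately show ?thesis
      using aff_length_ge[OF v _ l, of "reflection D \<gamma> \<cdot> w" \<mu>'] r\<gamma> w vl 1
      unfolding len_x y' by (simp add: \<mu>'_def wmult_in_W)
  next
    case 2
    \<comment> \<open>Now \<mu>' is the reflection of \<mu> in \<gamma>, so u stays and v is
      multiplied by that reflection. The positive root among \<gamma> and - \<gamma> pairs
      negatively with \<mu>, which makes v shorter.\<close>
    define \<gamma>' where "\<gamma>' = (if n > 0 then \<gamma> else - \<gamma>)"
    have \<gamma>': "\<gamma>' \<in> Pos" "\<langle>\<mu>,\<gamma>'\<rangle> < 0" "reflection D \<gamma>' = reflection D \<gamma>"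
      using pos_nonneg pos_neg 2 \<gamma>R by (auto simp: \<gamma>'_def m_def pairing_simps reflection_minus)
    then have "act_root (winv v) \<gamma>' \<notin> Pos" using dominant_Pos[OF l] v
      by (fastforce simp: vl pairing_act_left)
    then have "- act_root (winv v) \<gamma>' \<in> Pos"
      using Roots_Pos_or_Neg[of "act_root (winv v) \<gamma>'"] \<gamma>' v by (simp add: act_in_Roots winv_in_W Pos_in_Roots)
    then have "len (reflection D \<gamma> \<cdot> v) < len v"
      using len_reflection_wmult_less[OF v \<gamma>'(1)] \<gamma>'(3) by simp
    moreover have "winv (reflection D \<gamma> \<cdot> v) \<cdot> (reflection D \<gamma> \<cdot> w) = u"
      using v r\<gamma> \<gamma>R by (simp add: u_def winv_wmult_distrib winv_reflection wmult_assoc[symmetric]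
          wmult_reflection_cancel)
    moreover have "\<mu>' = act_coweight (reflection D \<gamma> \<cdot> v) l"
      using 2 by (simp add: \<mu>'_def act_reflection vl[symmetric] m_def zmod.scale_minus_left
          eq_neg_iff_add_eq_0[symmetric])
    ultimately show ?thesis
      using aff_length_ge[OF _ _ l, of "reflection D \<gamma> \<cdot> v" "reflection D \<gamma> \<cdot> w" \<mu>'] r\<gamma> w v
      unfolding len_x y' by (simp add: wmult_in_W)
  next
    case 3
    \<comment> \<open>The translation must be a positive multiple of a positive coroot: n times that
      of \<delta> starting the form \<open>\<nu>1\<close>, or m times that of - \<delta> in the form
      \<open>\<nu>2\<close>. For negative m and n the two forms are exchanged.\<close>
    show ?thesis
    proof (cases "\<delta> \<in> Pos")
      case True
      then show ?thesis
        using aff_length_translate[OF v u True _ _ \<nu>1_cone, of "n" l] 3 \<nu>1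
        unfolding len_x y' y'' by (simp add: \<nu>1_def)
    next
      case False
      then have minus: "- \<delta> \<in> Pos" using Roots_Pos_or_Neg[OF \<delta>R] by blast
      show ?thesis
        using aff_length_translate_reflect[OF v u minus _ _ \<nu>2_cone, of "m" l] 3 \<nu>2
        unfolding len_x y' y'' by (simp add: \<nu>2_def coroot_minus reflection_minus \<delta>R zmod.scale_minus_left)
    qed
  next
    case 4
    show ?thesis
    proof (cases "\<delta> \<in> Pos")
      case True
      then show ?thesis
        using aff_length_translate_reflect[OF v u True _ _ \<nu>2_cone, of "- m" l] 4 \<nu>2
        unfolding len_x y' y'' by (simp add: \<nu>2_def)
    next
      case False
      then have minus: "- \<delta> \<in> Pos" using Roots_Pos_or_Neg[OF \<delta>R] by blast
      show ?thesis
        using aff_length_translate[OF v u minus _ _ \<nu>1_cone, of "- n" l] 4 \<nu>1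
        unfolding len_x y' y'' by (simp add: \<nu>1_def coroot_minus reflection_minus \<delta>R zmod.scale_minus_left)
    qed
  qed
qed

end

end

theorem theorem1p3:
  fixes D :: "('i, 'p::ab_group_add) km_datum"
    and \<rho> :: "'p \<Rightarrow> real"
    and x y :: "('i, 'p) aff_weyl"
  assumes "km_root_datum D"
    and "is_rho D \<rho>"
    and "x \<in> aff_weyl_semigroup D"
    and "y \<in> aff_weyl_semigroup D"
    and "bruhat_le D x y"
    and "x \<noteq> y"
  shows "aff_length D \<rho> x < aff_length D \<rho> y"
proof -
  interpret km_root_datum D by (rule assms(1))
  have "x = y \<or> aff_length D \<rho> x < aff_length D \<rho> y"
    using assms(5) unfolding bruhat_le_def
  proof (induction rule: rtranclp_induct)
    case (step y z)
    then show ?case using aff_length_step[OF assms(2), of y z] by fastforce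
  qed simp
  then show ?thesis using assms(6) by simp
qed

end
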